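(* Let $(\Omega,\Sigma)$ be a standard Borel space and let $V=BC\cap AC_4$. The mapping $\partial^+_{\emptyset}:V\to NA$, $\nu\mapsto\partial^+_{\emptyset}(\nu,\cdot)$, which sends a game to its Burkill-Cesari integral, is a semivalue on $V$.
   Context: A game is a set function $\nu:\Sigma\to\mathbb{R}$ with $\nu(\emptyset)=0$; it is monotone if $\nu(A)\le\nu(B)$ whenever $A\subseteq B$. $NA$ is the space of (finite signed) nonatomic countably additive measures on $\Sigma$, and $NA^+$ its nonnegative elements. A chain is a finite sequence $\emptyset=S_0\subset S_1\subset\dots\subset S_m=\Omega$ in $\Sigma$; a subchain $\Lambda$ is a set of links $(S_{i-1},S_i)$ of a chain, and $\|\nu\|_\Lambda$ is the sum of $|\nu(S_i)-\nu(S_{i-1})|$ over the links in $\Lambda$. $BV$ is the space of games with $\|\nu\|=\sup_C\|\nu\|_C<\infty$ over all chains $C$. For $\mu\in NA^+$, $\nu\ll_4\mu$ means: for every $\varepsilon>0$ there is $\delta>0$ such that for every subchain $\Lambda$ of every chain, $\|\mu\|_\Lambda<\delta$ implies $\|\nu\|_\Lambda<\varepsilon$. $AC_4$ is the space of games $\nu$ with $\nu\ll_4\mu$ for some $\mu\in NA^+$; one has $AC_4\subset BV$. For $E\in\Sigma$, $\Pi(E)$ is the set of finite partitions of $E$ into disjoint elements of $\Sigma$. For $\lambda\in NA^+$ and $D\in\Pi(E)$ put $\delta_\lambda(D)=\max\{\lambda(I):I\in D\}$. A game $\nu$ is $\delta_\lambda$-BC (Burkill-Cesari) integrable if for every $E\in\Sigma$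 the finite limit $\partial^+_{\emptyset}(\nu,E):=\lim_{\delta_\lambda(D)\to0,\,D\in\Pi(E)}\sum_{I\in D}\nu(I)$ exists, i.e. for every $\varepsilon>0$ there is $\delta>0$ such that $|\sum_{I\in D}\nu(I)-\partial^+_{\emptyset}(\nu,E)|<\varepsilon$ for all $D\in\Pi(E)$ with $\delta_\lambda(D)<\delta$. $BC$ is the space of games that are $\delta_\lambda$-BC integrable for some $\lambda\in NA^+$; the integral $\partial^+_{\emptyset}(\nu,\cdot)$ is known not to depend on the choice of such $\lambda$. $\mathcal G$ is the group of automorphisms of $(\Omega,\Sigma)$ (bijections of $\Omega$ measurable in both directions); for $\vartheta\in\mathcal G$, $(\vartheta_*\nu)(E)=\nu(\vartheta(E))$. A subspace of $BV$ is symmetric if it is invariant under every $\vartheta_*$. A semivalue on a symmetric subspace $W$ of $BV$ is a linear mapping $\varphi:W\to NA$ such that (symmetry) $\vartheta_*(\varphi(\nu))=\varphi(\vartheta_*\nu)$ for all $\vartheta\in\mathcal G$, $\nu\in W$; (positivity) $\varphi(\nu)\ge0$ for every monotone $\nu\in W$; and $\varphi(\nu)=\nu$ for $\nu\in NA\cap W$. *)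

theory Defs
  imports "HOL-Analysis.Analysis"
begin

text \<open>
  The measurable space $(\Omega,\Sigma)$ is (\<^term>\<open>space M\<close>, \<^term>\<open>sets M\<close>) for
  \<^term>\<open>M :: 'a measure\<close>; the measure carried by \<^term>\<open>M\<close> is never used.
\<close>

definition standard_borel :: "'a measure \<Rightarrow> bool" where
  "standard_borel M \<longleftrightarrow>
     (\<exists>X. completely_metrizable_space X \<and> separable_space X \<and> topspace X = space M \<and>
          sets M = sigma_sets (space M) {U. openin X U})"

text \<open>
  A set function on $\Sigma$ is represented by a total function that is \<open>0\<close> outside $\Sigma$, so that
  equality of such functions is equality on $\Sigma$ and the vector space operations are pointwise.
\<close>

type_synonym 'a setfun = "'a set \<Rightarrow> real"

definition game :: "'a measure \<Rightarrow> 'a setfun \<Rightarrow> bool" where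
  "game M \<nu> \<longleftrightarrow> \<nu> {} = 0 \<and> (\<forall>A. A \<notin> sets M \<longrightarrow> \<nu> A = 0)"

definition monotone_game :: "'a measure \<Rightarrow> 'a setfun \<Rightarrow> bool" where
  "monotone_game M \<nu> \<longleftrightarrow> mono_on (sets M) \<nu>"

definition signed_measure :: "'a measure \<Rightarrow> 'a setfun \<Rightarrow> bool" where
  "signed_measure M \<mu> \<longleftrightarrow> game M \<mu> \<and>
     (\<forall>A :: nat \<Rightarrow> 'a set. range A \<subseteq> sets M \<longrightarrow> disjoint_family A \<longrightarrow>
        (\<lambda>i. \<mu> (A i)) sums \<mu> (\<Union>i. A i))"

definition atom :: "'a measure \<Rightarrow> 'a setfun \<Rightarrow> 'a set \<Rightarrow> bool" where
  "atom M \<mu> A \<longleftrightarrow> A \<in> sets M \<and> \<mu> A \<noteq> 0 \<and>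
     (\<forall>B \<in> sets M. B \<subseteq> A \<longrightarrow> \<mu> B = 0 \<or> \<mu> (A - B) = 0)"

definition NA :: "'a measure \<Rightarrow> 'a setfun set" where
  "NA M = {\<mu>. signed_measure M \<mu> \<and> (\<nexists>A. atom M \<mu> A)}"

definition NA_plus :: "'a measure \<Rightarrow> 'a setfun set" where
  "NA_plus M = {\<mu> \<in> NA M. \<forall>A \<in> sets M. 0 \<le> \<mu> A}"

text \<open>
  Inclusions in a chain need not be strict; a degenerate link $(S,S)$ contributes \<open>0\<close> to every
  variation.
\<close>

definition chain_of :: "'a measure \<Rightarrow> 'a set list \<Rightarrow> bool" where
  "chain_of M C \<longleftrightarrow> C \<noteq> [] \<and> hd C = {} \<and> last C = space M \<and> set C \<subseteq> sets M \<and>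
     (\<forall>i. Suc i < length C \<longrightarrow> C ! i \<subseteq> C ! Suc i)"

definition links :: "'a set list \<Rightarrow> ('a set \<times> 'a set) set" where
  "links C = {(C ! i, C ! Suc i) | i. Suc i < length C}"

definition subchain :: "'a measure \<Rightarrow> ('a set \<times> 'a set) set \<Rightarrow> bool" where
  "subchain M \<Lambda> \<longleftrightarrow> (\<exists>C. chain_of M C \<and> \<Lambda> \<subseteq> links C)"

definition variation :: "'a setfun \<Rightarrow> ('a set \<times> 'a set) set \<Rightarrow> real" where
  "variation \<nu> \<Lambda> = (\<Sum>(S, T) \<in> \<Lambda>. \<bar>\<nu> T - \<nu> S\<bar>)"

definition BV :: "'a measure \<Rightarrow> 'a setfun set" where
  "BV M = {\<nu>. game M \<nu> \<and> bdd_above {variation \<nu> (links C) | C. chain_of M C}}"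

definition abs_cont4 :: "'a measure \<Rightarrow> 'a setfun \<Rightarrow> 'a setfun \<Rightarrow> bool" where
  "abs_cont4 M \<nu> \<mu> \<longleftrightarrow>
     (\<forall>\<epsilon>>0. \<exists>\<delta>>0. \<forall>\<Lambda>. subchain M \<Lambda> \<longrightarrow> variation \<mu> \<Lambda> < \<delta> \<longrightarrow> variation \<nu> \<Lambda> < \<epsilon>)"

definition AC4 :: "'a measure \<Rightarrow> 'a setfun set" where
  "AC4 M = {\<nu>. game M \<nu> \<and> (\<exists>\<mu> \<in> NA_plus M. abs_cont4 M \<nu> \<mu>)}"

text \<open>
  \<^const>\<open>partition_on\<close> excludes empty blocks; these would affect neither the mesh nor the sums.
\<close>

definition partitions :: "'a measure \<Rightarrow> 'a set \<Rightarrow> 'a set set set" where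
  "partitions M E = {D. finite D \<and> D \<subseteq> sets M \<and> partition_on E D}"

text \<open>
  Inserting \<open>0\<close> only matters for the empty partition of the empty set, since $\kappa \ge 0$.
\<close>

definition mesh :: "'a setfun \<Rightarrow> 'a set set \<Rightarrow> real" where
  "mesh \<kappa> D = Max (insert 0 (\<kappa> ` D))"

definition has_BC_limit :: "'a measure \<Rightarrow> 'a setfun \<Rightarrow> 'a setfun \<Rightarrow> 'a set \<Rightarrow> real \<Rightarrow> bool" where
  "has_BC_limit M \<kappa> \<nu> E L \<longleftrightarrow>
     (\<forall>\<epsilon>>0. \<exists>\<delta>>0. \<forall>D \<in> partitions M E. mesh \<kappa> D < \<delta> \<longrightarrow> \<bar>(\<Sum>I\<in>D. \<nu> I) - L\<bar> < \<epsilon>)"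

definition BC_integrable :: "'a measure \<Rightarrow> 'a setfun \<Rightarrow> 'a setfun \<Rightarrow> bool" where
  "BC_integrable M \<kappa> \<nu> \<longleftrightarrow> (\<forall>E \<in> sets M. \<exists>L. has_BC_limit M \<kappa> \<nu> E L)"

definition BC :: "'a measure \<Rightarrow> 'a setfun set" where
  "BC M = {\<nu>. game M \<nu> \<and> (\<exists>\<kappa> \<in> NA_plus M. BC_integrable M \<kappa> \<nu>)}"

text \<open>
  For \<open>\<nu> \<in> BC M\<close> the value does not depend on the choice of \<open>\<kappa>\<close>, so the description is proper.
\<close>

definition BC_integral :: "'a measure \<Rightarrow> 'a setfun \<Rightarrow> 'a setfun" where
  "BC_integral M \<nu> = (\<lambda>E. if E \<in> sets M
     then (THE L. \<exists>\<kappa> \<in> NA_plus M. BC_integrable M \<kappa> \<nu> \<and> has_BC_limit M \<kappa> \<nu> E L)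
     else 0)"

definition automorphisms :: "'a measure \<Rightarrow> ('a \<Rightarrow> 'a) set" where
  "automorphisms M = {\<theta>. bij_betw \<theta> (space M) (space M) \<and>
     \<theta> \<in> measurable M M \<and> inv_into (space M) \<theta> \<in> measurable M M}"

definition act :: "'a measure \<Rightarrow> ('a \<Rightarrow> 'a) \<Rightarrow> 'a setfun \<Rightarrow> 'a setfun" where
  "act M \<theta> \<nu> = (\<lambda>E. if E \<in> sets M then \<nu> (\<theta> ` E) else 0)"

definition symmetric_subspace :: "'a measure \<Rightarrow> 'a setfun set \<Rightarrow> bool" where
  "symmetric_subspace M W \<longleftrightarrow> W \<subseteq> BV M \<and>
     (\<lambda>A. 0) \<in> W \<and>
     (\<forall>\<nu>\<in>W. \<forall>\<nu>'\<in>W. (\<lambda>A. \<nu> A + \<nu>' A) \<in> W) \<and>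
     (\<forall>c. \<forall>\<nu>\<in>W. (\<lambda>A. c * \<nu> A) \<in> W) \<and>
     (\<forall>\<theta>\<in>automorphisms M. \<forall>\<nu>\<in>W. act M \<theta> \<nu> \<in> W)"

definition semivalue :: "'a measure \<Rightarrow> 'a setfun set \<Rightarrow> ('a setfun \<Rightarrow> 'a setfun) \<Rightarrow> bool" where
  "semivalue M W \<phi> \<longleftrightarrow> symmetric_subspace M W \<and>
     (\<forall>\<nu>\<in>W. \<phi> \<nu> \<in> NA M) \<and>
     (\<forall>\<nu>\<in>W. \<forall>\<nu>'\<in>W. \<phi> (\<lambda>A. \<nu> A + \<nu>' A) = (\<lambda>A. \<phi> \<nu> A + \<phi> \<nu>' A)) \<and>
     (\<forall>c. \<forall>\<nu>\<in>W. \<phi> (\<lambda>A. c * \<nu> A) = (\<lambda>A. c * \<phi> \<nu> A)) \<and>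
     (\<forall>\<theta>\<in>automorphisms M. \<forall>\<nu>\<in>W. act M \<theta> (\<phi> \<nu>) = \<phi> (act M \<theta> \<nu>)) \<and>
     (\<forall>\<nu>\<in>W. monotone_game M \<nu> \<longrightarrow> (\<forall>E\<in>sets M. 0 \<le> \<phi> \<nu> E)) \<and>
     (\<forall>\<nu>\<in>NA M \<inter> W. \<phi> \<nu> = \<nu>)"

end

(*
  The sums of a game over partitions of a subset A of the whole space can be compared by extending
  the partitions by a common partition of the complement of A. Hence one modulus of convergence
  serves all A at once, and |nu A - m A| is small as soon as A is kappa-small, where m is the
  Burkill-Cesari integral. Since nu << mu, the finitely additive m is absolutely continuous with
  respect to the nonatomic measure kappa + mu, so it is countably additive and nonatomic.
*)

theory Submission
  imports Defs
begin

text \<open>Nonatomicity of the control measure gives the limits their content. It supplies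
  partitions of arbitrarily small mesh on every measurable set; without them every number would be a
  limit vacuously. Uniqueness, additivity, positivity and nonatomicity of the integral all rest on
  this existence result. Limits taken against two control measures are compared through the sum of
  the measures: a partition fine for the sum is fine for both, and the sum is again nonatomic. The
  obstacle to countable additivity is that the modulus in the definition may depend on the set,
  while a sequence decreasing to the empty set needs one estimate for all its members. Moreover,
  integrability only brings \<open>\<nu>\<close> close to its integral on small sets. That
  \<open>\<nu>\<close> itself is small there comes from \<open>abs_cont4\<close>, applied to the one
  link from \<open>{}\<close> to the set. The same condition, applied to many interleaved links at
  once, bounds the variation and puts the domain inside \<open>BV\<close>.\<close>

section \<open>Signed measures\<close>

lemma signed_measure_empty: "signed_measure M \<mu> \<Longrightarrow> \<mu> {} = 0"
  by (simp add: signed_measure_def game_def)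

text \<open>The axiom speaks of sequences only; \<open>binaryset\<close> pads the two sets with
  empty ones, whose value is 0.\<close>

lemma signed_measure_Un:
  assumes \<mu>: "signed_measure M \<mu>" and "A \<in> sets M" "B \<in> sets M" "A \<inter> B = {}"
  shows "\<mu> (A \<union> B) = \<mu> A + \<mu> B"
proof -
  have "range (binaryset A B) \<subseteq> sets M"
    using assms by (auto simp: range_binaryset_eq)
  moreover have "disjoint_family (binaryset A B)"
    using assms(4) by (auto simp: disjoint_family_on_def binaryset_def)
  ultimately have "(\<lambda>i. \<mu> (binaryset A B i)) sums \<mu> (A \<union> B)"
    using \<mu> UN_binaryset_eq[of A B] unfolding signed_measure_def by metis
  moreover have "(\<lambda>i. \<mu> (binaryset A B i)) sums (\<mu> A + \<mu> B)"
    by (rule binaryset_sums) (rule signed_measure_empty[OF \<mu>])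
  ultimately show ?thesis
    by (rule sums_unique2)
qed

lemma signed_measure_Diff:
  assumes "signed_measure M \<mu>" "A \<in> sets M" "B \<in> sets M" "B \<subseteq> A"
  shows "\<mu> (A - B) = \<mu> A - \<mu> B"
  using signed_measure_Un[OF assms(1), of "A - B" B] assms
  by (simp add: Un_absorb2 Diff_disjoint inf_commute)

lemma signed_measure_Union:
  assumes "signed_measure M \<mu>" "finite D" "D \<subseteq> sets M" "disjoint D"
  shows "\<mu> (\<Union>D) = (\<Sum>I\<in>D. \<mu> I)"
  using assms(2-)
proof (induction D rule: finite_induct)
  case empty
  then show ?case by (simp add: signed_measure_empty[OF assms(1)])
next
  case (insert I D)
  have "I \<inter> \<Union>D = {}"
    using insert.prems(2) insert.hyps(2) by (fastforce simp: disjoint_def)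
  moreover have "\<Union>D \<in> sets M"
    using insert by (auto intro: sets.finite_Union)
  moreover have "disjoint D"
    using insert.prems(2) by (auto simp: disjoint_def)
  ultimately show ?case
    using insert signed_measure_Un[OF assms(1), of I "\<Union>D"] by simp
qed

text \<open>The layers \<open>A k - A (Suc k)\<close> disjointly fill \<open>A 0\<close>, so their
  partial sums, which telescope to \<open>\<mu> (A 0) - \<mu> (A n)\<close>, converge to
  \<open>\<mu> (A 0)\<close>.\<close>

lemma signed_measure_decseq:
  assumes \<mu>: "signed_measure M \<mu>" and A: "range A \<subseteq> sets M" "decseq A" "(\<Inter>n. A n) = {}"
  shows "(\<lambda>n. \<mu> (A n)) \<longlonglongrightarrow> 0"
proof -
  define D where "D k = A k - A (Suc k)" for k
  have sub: "A n \<subseteq> A m" if "m \<le> n" for m n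
    using A(2) that by (auto simp: decseq_def)
  have "disjoint_family D"
    unfolding disjoint_family_on_def
  proof (intro ballI impI)
    fix m n :: nat
    assume "m \<noteq> n"
    then have "Suc m \<le> n \<or> Suc n \<le> m" by auto
    then show "D m \<inter> D n = {}"
      using sub[of "Suc m" n] sub[of "Suc n" m] by (auto simp: D_def)
  qed
  moreover have "(\<Union>k. D k) = A 0"
  proof (intro equalityI subsetI)
    fix x assume x: "x \<in> A 0"
    obtain n where n: "x \<notin> A n" using A(3) by blast
    define k where "k = (LEAST n. x \<notin> A n)"
    have k: "x \<notin> A k" unfolding k_def by (rule LeastI) (rule n)
    then obtain j where j: "k = Suc j" using x by (cases k) auto
    then have "x \<in> A j" using not_less_Least[of j "\<lambda>n. x \<notin> A n"] k_def by auto
    then show "x \<in> (\<Union>k. D k)" using k j by (auto simp: D_def)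
  qed (use sub in \<open>auto simp: D_def\<close>)
  moreover have "range D \<subseteq> sets M"
    using A(1) by (auto simp: D_def)
  ultimately have "(\<lambda>k. \<mu> (D k)) sums \<mu> (A 0)"
    using \<mu> unfolding signed_measure_def by metis
  moreover have "\<mu> (D k) = \<mu> (A k) - \<mu> (A (Suc k))" for k
    unfolding D_def by (rule signed_measure_Diff[OF \<mu>]) (use A sub in auto)
  ultimately have "(\<lambda>n. \<Sum>k<n. \<mu> (A k) - \<mu> (A (Suc k))) \<longlonglongrightarrow> \<mu> (A 0)"
    by (simp add: sums_def)
  then have "(\<lambda>n. \<mu> (A 0) - \<mu> (A n)) \<longlonglongrightarrow> \<mu> (A 0)"
    by (subst (asm) sum_lessThan_telescope'[where f = "\<lambda>n. \<mu> (A n)"])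
  from tendsto_diff[OF tendsto_const[of "\<mu> (A 0)"] this] show ?thesis
    by simp
qed

text \<open>The tails \<open>R n\<close> of a disjoint sequence decrease to the empty set, and by
  finite additivity \<open>m (R n)\<close> is exactly the error of the \<open>n\<close>-th partial
  sum. The integral is shown to be a measure through this criterion.\<close>

lemma signed_measureI:
  assumes "game M m"
    and add: "\<And>A B. A \<in> sets M \<Longrightarrow> B \<in> sets M \<Longrightarrow> A \<inter> B = {} \<Longrightarrow> m (A \<union> B) = m A + m B"
    and cont: "\<And>A. range A \<subseteq> sets M \<Longrightarrow> decseq A \<Longrightarrow> (\<Inter>n::nat. A n) = {} \<Longrightarrow> (\<lambda>n. m (A n)) \<longlonglongrightarrow> 0"
  shows "signed_measure M m"
  unfolding signed_measure_def
proof (intro conjI allI impI)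
  show "game M m" by fact
  fix A :: "nat \<Rightarrow> 'a set"
  assume A: "range A \<subseteq> sets M" and disj: "disjoint_family A"
  define R where "R n = (\<Union>i\<in>{n..}. A i)" for n
  have R_sets: "R n \<in> sets M" for n
    unfolding R_def using A by (intro sets.countable_UN') auto
  have R_Suc: "R n = A n \<union> R (Suc n)" "A n \<inter> R (Suc n) = {}" for n
  proof -
    have "{n..} = insert n {Suc n..}" by auto
    then show "R n = A n \<union> R (Suc n)" by (simp add: R_def)
    show "A n \<inter> R (Suc n) = {}"
    proof (rule equals0I)
      fix x assume "x \<in> A n \<inter> R (Suc n)"
      then obtain i where "i \<ge> Suc n" "x \<in> A n \<inter> A i" by (auto simp: R_def)
      then show False using disjoint_family_onD[OF disj, of n i] by auto
    qed
  qed
  have R_0: "R 0 = (\<Union>i. A i)" by (simp add: R_def)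
  have sum: "(\<Sum>i<n. m (A i)) = m (\<Union>i. A i) - m (R n)" for n
  proof (induction n)
    case (Suc n)
    have "m (R n) = m (A n) + m (R (Suc n))"
      using add[of "A n" "R (Suc n)"] R_Suc[of n] R_sets A by auto
    with Suc show ?case by simp
  qed (simp add: R_0)
  have "(\<Inter>n. R n) = {}"
  proof (rule equals0I)
    fix x assume x: "x \<in> (\<Inter>n. R n)"
    then obtain i where "x \<in> A i" using R_0 by blast
    moreover have "x \<in> R (Suc i)" using x by blast
    ultimately show False using R_Suc(2)[of i] by blast
  qed
  then have "(\<lambda>n. m (R n)) \<longlonglongrightarrow> 0"
    using R_sets by (intro cont) (auto simp: R_def decseq_def)
  from tendsto_diff[OF tendsto_const[of "m (\<Union>i. A i)"] this]
  show "(\<lambda>i. m (A i)) sums m (\<Union>i. A i)"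
    by (simp add: sums_def sum)
qed

section \<open>Nonatomic measures and fine partitions\<close>

lemma NA_plusD:
  assumes "\<mu> \<in> NA_plus M"
  shows "signed_measure M \<mu>" "game M \<mu>" "\<mu> {} = 0" "\<And>A. \<not> atom M \<mu> A"
    "\<And>A. A \<in> sets M \<Longrightarrow> 0 \<le> \<mu> A"
  using assms by (auto simp: NA_plus_def NA_def signed_measure_def game_def)

lemma NA_plus_mono:
  assumes "\<mu> \<in> NA_plus M" "A \<in> sets M" "B \<in> sets M" "A \<subseteq> B"
  shows "\<mu> A \<le> \<mu> B"
  using signed_measure_Diff[OF NA_plusD(1)[OF assms(1)], of B A] NA_plusD(5)[OF assms(1), of "B - A"] assms
  by auto

text \<open>A sum of nonnegative values vanishes only if both do. Hence an atom of the sum would be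
  an atom of whichever summand is nonzero on it.\<close>

lemma NA_plus_add:
  assumes \<mu>: "\<mu> \<in> NA_plus M" and \<kappa>: "\<kappa> \<in> NA_plus M"
  shows "(\<lambda>A. \<mu> A + \<kappa> A) \<in> NA_plus M"
proof -
  let ?\<sigma> = "\<lambda>A. \<mu> A + \<kappa> A"
  note \<mu>D = NA_plusD[OF \<mu>] and \<kappa>D = NA_plusD[OF \<kappa>]
  have "signed_measure M ?\<sigma>"
    using \<mu>D(1) \<kappa>D(1) by (auto simp: signed_measure_def game_def intro!: sums_add)
  moreover have "\<not> atom M ?\<sigma> A" for A
  proof
    assume A: "atom M ?\<sigma> A"
    then have *: "A \<in> sets M" "\<mu> A + \<kappa> A \<noteq> 0"
      and **: "\<And>B. B \<in> sets M \<Longrightarrow> B \<subseteq> A \<Longrightarrow> \<mu> B + \<kappa> B = 0 \<or> \<mu> (A - B) + \<kappa> (A - B) = 0"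
      by (auto simp: atom_def)
    have "(\<mu> B = 0 \<and> \<kappa> B = 0) \<or> (\<mu> (A - B) = 0 \<and> \<kappa> (A - B) = 0)" if B: "B \<in> sets M" "B \<subseteq> A" for B
    proof -
      have "A - B \<in> sets M" using B * by auto
      then show ?thesis
        using **[OF B] \<mu>D(5)[of B] \<kappa>D(5)[of B] \<mu>D(5)[of "A - B"] \<kappa>D(5)[of "A - B"] B by linarith
    qed
    then have "\<mu> A \<noteq> 0 \<Longrightarrow> atom M \<mu> A" "\<kappa> A \<noteq> 0 \<Longrightarrow> atom M \<kappa> A"
      using * unfolding atom_def by blast+
    then show False using \<mu>D(4) \<kappa>D(4) *(2) by (metis add.right_neutral)
  qed
  ultimately show ?thesis
    using \<mu>D(5) \<kappa>D(5) by (auto simp: NA_plus_def NA_def)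
qed

lemma zero_NA_plus: "(\<lambda>A. 0) \<in> NA_plus M"
  by (auto simp: NA_plus_def NA_def signed_measure_def game_def atom_def)

text \<open>Since \<open>A\<close> is not an atom, it splits into two pieces of nonzero, hence
  positive, measure; the smaller has at most half.\<close>

lemma NA_plus_halve:
  assumes \<kappa>: "\<kappa> \<in> NA_plus M" and A: "A \<in> sets M" "0 < \<kappa> A"
  shows "\<exists>B\<in>sets M. B \<subseteq> A \<and> 0 < \<kappa> B \<and> \<kappa> B \<le> \<kappa> A / 2"
proof -
  note D = NA_plusD[OF \<kappa>]
  from D(4)[of A] A obtain B where B: "B \<in> sets M" "B \<subseteq> A" "\<kappa> B \<noteq> 0" "\<kappa> (A - B) \<noteq> 0"
    by (auto simp: atom_def)
  have AB: "A - B \<in> sets M" using A B by auto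
  have eq: "\<kappa> (A - B) = \<kappa> A - \<kappa> B"
    by (rule signed_measure_Diff[OF D(1)]) (use A B in auto)
  have pos: "0 < \<kappa> B" "0 < \<kappa> (A - B)"
    using D(5)[OF B(1)] D(5)[OF AB] B by linarith+
  show ?thesis
  proof (cases "\<kappa> B \<le> \<kappa> A / 2")
    case True
    then show ?thesis using B pos by blast
  next
    case False
    then have "\<kappa> (A - B) \<le> \<kappa> A / 2" using eq by linarith
    then show ?thesis using AB pos by blast
  qed
qed

text \<open>Repeated halving keeps the measure positive while the bound
  \<open>\<kappa> A / 2 ^ n\<close> tends to 0.\<close>

lemma NA_plus_small_subset:
  assumes \<kappa>: "\<kappa> \<in> NA_plus M" and A: "A \<in> sets M" "0 < \<kappa> A" and "0 < \<epsilon>"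
  shows "\<exists>B\<in>sets M. B \<subseteq> A \<and> 0 < \<kappa> B \<and> \<kappa> B \<le> \<epsilon>"
proof -
  have *: "\<exists>B\<in>sets M. B \<subseteq> A \<and> 0 < \<kappa> B \<and> \<kappa> B \<le> \<kappa> A / 2 ^ n" for n :: nat
  proof (induction n)
    case 0
    then show ?case using A by auto
  next
    case (Suc n)
    then obtain B where B: "B \<in> sets M" "B \<subseteq> A" "0 < \<kappa> B" "\<kappa> B \<le> \<kappa> A / 2 ^ n" by blast
    from NA_plus_halve[OF \<kappa> B(1,3)] obtain B' where
      "B' \<in> sets M" "B' \<subseteq> B" "0 < \<kappa> B'" "\<kappa> B' \<le> \<kappa> B / 2" by blast
    moreover from this have "\<kappa> B' \<le> (\<kappa> A / 2 ^ n) / 2"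
      using B(4) by (meson divide_right_mono order_trans zero_le_numeral)
    ultimately show ?case using B by (intro bexI[of _ B']) (auto simp: mult.commute)
  qed
  obtain n :: nat where n: "\<kappa> A / \<epsilon> < 2 ^ n"
    using real_arch_pow[of 2 "\<kappa> A / \<epsilon>"] by auto
  then have "\<kappa> A / 2 ^ n \<le> \<epsilon>" using \<open>0 < \<epsilon>\<close> by (simp add: field_simps)
  then show ?thesis using *[of n] by (meson order_trans)
qed

section \<open>Finite partitions and their mesh\<close>

lemma mesh_less_iff: "finite D \<Longrightarrow> mesh \<kappa> D < \<delta> \<longleftrightarrow> 0 < \<delta> \<and> (\<forall>I\<in>D. \<kappa> I < \<delta>)"
  by (simp add: mesh_def)

lemma partitionsD:
  assumes "D \<in> partitions M E"
  shows "finite D" "D \<subseteq> sets M" "partition_on E D" "\<Union>D = E" "disjoint D" "{} \<notin> D"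
  using assms by (auto simp: partitions_def partition_on_def)

lemma partitions_Un:
  assumes "D \<in> partitions M A" "D' \<in> partitions M B" "A \<inter> B = {}"
  shows "D \<union> D' \<in> partitions M (A \<union> B)"
    and "(\<Sum>I\<in>D \<union> D'. f I) = (\<Sum>I\<in>D. f I) + (\<Sum>I\<in>D'. f I)"
proof -
  note D = partitionsD[OF assms(1)] and D' = partitionsD[OF assms(2)]
  have sep: "I \<inter> J = {}" if "I \<in> D" "J \<in> D'" for I J
    using that D(4) D'(4) assms(3) by blast
  have "disjoint (D \<union> D')"
    using D(5) D'(5) sep unfolding disjoint_def by blast
  then show "D \<union> D' \<in> partitions M (A \<union> B)"
    using D D' by (auto simp: partitions_def partition_on_def)
  \<comment> \<open>A common block would be disjoint from itself, hence empty, and blocks are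
    nonempty.\<close>
  have "D \<inter> D' = {}"
    using sep D(6) by (metis Int_absorb disjoint_iff)
  then show "(\<Sum>I\<in>D \<union> D'. f I) = (\<Sum>I\<in>D. f I) + (\<Sum>I\<in>D'. f I)"
    using D(1) D'(1) by (simp add: sum.union_disjoint)
qed

lemma partitions_singleton: "E \<in> sets M \<Longrightarrow> (if E = {} then {} else {E}) \<in> partitions M E"
  by (auto simp: partitions_def partition_on_def)

lemma fine_partition_singleton:
  assumes "E \<in> sets M" "0 < \<epsilon>" "\<kappa> E < \<epsilon>"
  shows "\<exists>D\<in>partitions M E. mesh \<kappa> D < \<epsilon>"
  using partitions_singleton[OF assms(1)] assms(2,3)
  by (intro bexI[of _ "if E = {} then {} else {E}"]) (auto simp: mesh_less_iff)

lemma fine_partition_Un: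
  assumes "\<exists>D\<in>partitions M A. mesh \<kappa> D < \<epsilon>" "\<exists>D\<in>partitions M B. mesh \<kappa> D < \<epsilon>" "A \<inter> B = {}"
  shows "\<exists>D\<in>partitions M (A \<union> B). mesh \<kappa> D < \<epsilon>"
proof -
  obtain D D' where *: "D \<in> partitions M A" "mesh \<kappa> D < \<epsilon>" "D' \<in> partitions M B" "mesh \<kappa> D' < \<epsilon>"
    using assms by blast
  then have "mesh \<kappa> (D \<union> D') < \<epsilon>"
    using partitionsD(1)[OF *(1)] partitionsD(1)[OF *(3)] by (auto simp: mesh_less_iff)
  then show ?thesis using partitions_Un(1)[OF *(1,3) assms(3)] by blast
qed

text \<open>
  Pieces of measure at most \<open>\<epsilon>\<close> are removed greedily, each at least half as large as possible.
  Their measures tend to \<open>0\<close>, so what is never removed contains no small set of positive measure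
  and is therefore null.
\<close>
lemma NA_plus_fine_partition:
  assumes \<kappa>: "\<kappa> \<in> NA_plus M" and E: "E \<in> sets M" and \<epsilon>: "0 < \<epsilon>"
  shows "\<exists>D\<in>partitions M E. mesh \<kappa> D < \<epsilon>"
proof -
  note D = NA_plusD[OF \<kappa>]
  \<comment> \<open>Removed pieces are bounded by \<open>\<eta>\<close> non-strictly, while the mesh
    must be strictly below \<open>\<epsilon>\<close>.\<close>
  define \<eta> where "\<eta> = \<epsilon> / 2"
  have \<eta>: "0 < \<eta>" "\<eta> < \<epsilon>" using \<epsilon> by (auto simp: \<eta>_def)
  define small where "small R = {B \<in> sets M. B \<subseteq> R \<and> \<kappa> B \<le> \<eta>}" for R
  have step: "\<exists>R'\<in>sets M. R' \<subseteq> R \<and> \<kappa> (R - R') \<le> \<eta> \<and> (\<forall>B\<in>small R. \<kappa> B \<le> 2 * \<kappa> (R - R'))"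
    if R: "R \<in> sets M" for R
  proof -
    define s where "s = (SUP B\<in>small R. \<kappa> B)"
    have bdd: "bdd_above (\<kappa> ` small R)" by (auto simp: small_def)
    have ne: "{} \<in> small R" using D(3) \<eta> by (auto simp: small_def)
    have le: "\<kappa> B \<le> s" if "B \<in> small R" for B
      unfolding s_def using that bdd by (rule cSUP_upper)
    \<comment> \<open>The supremum need not be attained. If it is positive, some candidate exceeds
      its half; otherwise the empty set suffices.\<close>
    have "\<exists>B\<in>small R. s \<le> 2 * \<kappa> B"
    proof (cases "s \<le> 0")
      case True
      then show ?thesis using ne D(3) by (intro bexI[of _ "{}"]) auto
    next
      case False
      then have "s / 2 < (SUP B\<in>small R. \<kappa> B)" by (simp add: s_def)
      then obtain B where "B \<in> small R" "s / 2 < \<kappa> B"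
        using less_cSUP_iff[of "small R" \<kappa> "s / 2"] ne bdd by auto
      then show ?thesis by (intro bexI[of _ B]) auto
    qed
    then obtain B where B: "B \<in> small R" "s \<le> 2 * \<kappa> B" by blast
    then have "R - (R - B) = B" by (auto simp: small_def)
    then show ?thesis
      using B R le by (intro bexI[of _ "R - B"]) (auto simp: small_def intro: order_trans)
  qed
  \<comment> \<open>\<open>f n\<close> is what remains after \<open>n\<close> removals; the clause
    for \<open>n = 0\<close> starts the sequence at \<open>E\<close>.\<close>
  have "\<exists>f. \<forall>n. (f n \<in> sets M \<and> (n = 0 \<longrightarrow> f n = E)) \<and>
      (f (Suc n) \<subseteq> f n \<and> \<kappa> (f n - f (Suc n)) \<le> \<eta> \<and>
        (\<forall>B\<in>small (f n). \<kappa> B \<le> 2 * \<kappa> (f n - f (Suc n))))"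
  proof (rule dependent_nat_choice)
    show "\<exists>x. x \<in> sets M \<and> (0 = (0::nat) \<longrightarrow> x = E)" using E by auto
    fix R :: "'a set" and n :: nat
    assume "R \<in> sets M \<and> (n = 0 \<longrightarrow> R = E)"
    with step[of R] show "\<exists>y. (y \<in> sets M \<and> (Suc n = 0 \<longrightarrow> y = E)) \<and>
         y \<subseteq> R \<and> \<kappa> (R - y) \<le> \<eta> \<and> (\<forall>B\<in>small R. \<kappa> B \<le> 2 * \<kappa> (R - y))"
      by blast
  qed
  then obtain R where R_sets: "\<And>n. R n \<in> sets M" and R0: "R 0 = E"
    and R_sub: "\<And>n. R (Suc n) \<subseteq> R n" and R_le: "\<And>n. \<kappa> (R n - R (Suc n)) \<le> \<eta>"
    and R_big: "\<And>n B. B \<in> small (R n) \<Longrightarrow> \<kappa> B \<le> 2 * \<kappa> (R n - R (Suc n))"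
    by metis
  define I where "I = (\<Inter>n. R n)"
  have I_sets: "I \<in> sets M" unfolding I_def using R_sets by auto
  have I_sub: "I \<subseteq> R n" for n by (auto simp: I_def)
  have dec: "decseq R" using R_sub by (rule decseq_SucI)
  have "(\<lambda>n. \<kappa> (R n - I)) \<longlonglongrightarrow> 0"
  proof (rule signed_measure_decseq[OF D(1)])
    show "range (\<lambda>n. R n - I) \<subseteq> sets M" using R_sets I_sets by auto
    show "decseq (\<lambda>n. R n - I)" using dec unfolding decseq_def by blast
    show "(\<Inter>n. R n - I) = {}" unfolding I_def by blast
  qed
  moreover have diff: "\<kappa> (R n - I) = \<kappa> (R n) - \<kappa> I" for n
    by (rule signed_measure_Diff[OF D(1)]) (use R_sets I_sets I_sub in auto)
  ultimately have lim0: "(\<lambda>n. \<kappa> (R n) - \<kappa> I) \<longlonglongrightarrow> 0" by simp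
  have "\<kappa> I = 0"
  proof (rule ccontr)
    assume "\<kappa> I \<noteq> 0"
    then have "0 < \<kappa> I" using D(5)[OF I_sets] by simp
    from NA_plus_small_subset[OF \<kappa> I_sets this \<eta>(1)] obtain B
      where B: "B \<in> sets M" "B \<subseteq> I" "0 < \<kappa> B" "\<kappa> B \<le> \<eta>" by blast
    obtain n where n: "\<bar>\<kappa> (R n) - \<kappa> I\<bar> < \<kappa> B / 2"
      using LIMSEQ_D[OF lim0, of "\<kappa> B / 2"] B(3) by auto
    \<comment> \<open>\<open>B\<close> lies in every \<open>R n\<close> and so stays a candidate
      forever. Each removed piece would then have measure at least \<open>\<kappa> B / 2\<close>,
      although these measures tend to 0.\<close>
    have "\<kappa> B \<le> 2 * \<kappa> (R n - R (Suc n))"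
      using R_big[of B n] B I_sub by (auto simp: small_def)
    also have "\<kappa> (R n - R (Suc n)) \<le> \<kappa> (R n - I)"
      by (rule NA_plus_mono[OF \<kappa>]) (use R_sets I_sets I_sub in auto)
    finally show False using n diff[of n] by linarith
  qed
  moreover obtain n where "norm (\<kappa> (R n) - \<kappa> I - 0) < \<epsilon>"
    using LIMSEQ_D[OF lim0 \<epsilon>] by blast
  ultimately have n: "\<kappa> (R n) < \<epsilon>" by simp
  \<comment> \<open>Induction on \<open>k\<close> walks back from \<open>R n\<close>, by now small
    enough to be a single block, to \<open>R 0\<close>, adding one removed layer at each
    step.\<close>
  have "\<exists>D\<in>partitions M (R (n - k)). mesh \<kappa> D < \<epsilon>" if "k \<le> n" for k
    using that
  proof (induction k)
    case 0
    then show ?case using fine_partition_singleton[of "R n" M \<epsilon> \<kappa>] R_sets n \<epsilon> by simp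
  next
    case (Suc k)
    define j where "j = n - Suc k"
    have j: "n - k = Suc j" using Suc.prems by (simp add: j_def)
    have "\<exists>D\<in>partitions M (R j - R (Suc j)). mesh \<kappa> D < \<epsilon>"
      using R_sets R_le[of j] \<eta> \<epsilon> by (intro fine_partition_singleton) auto
    moreover have "\<exists>D\<in>partitions M (R (Suc j)). mesh \<kappa> D < \<epsilon>"
      using Suc j by simp
    moreover have "R j = (R j - R (Suc j)) \<union> R (Suc j)" using R_sub[of j] by blast
    ultimately show ?case
      using fine_partition_Un[of M "R j - R (Suc j)" \<kappa> \<epsilon> "R (Suc j)"] unfolding j_def[symmetric] by auto
  qed
  from this[of n] show ?thesis using R0 by simp
qed

section \<open>The Burkill-Cesari integral\<close>

text \<open>A small mesh for the larger \<open>\<kappa>'\<close> forces a small mesh for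
  \<open>\<kappa>\<close>, so fewer partitions have to be tested. This permits passing to a common
  control measure.\<close>

lemma has_BC_limit_mono:
  assumes "has_BC_limit M \<kappa> \<nu> E L" "\<And>A. A \<in> sets M \<Longrightarrow> \<kappa> A \<le> \<kappa>' A"
  shows "has_BC_limit M \<kappa>' \<nu> E L"
proof -
  have "mesh \<kappa> D < \<delta>" if "D \<in> partitions M E" "mesh \<kappa>' D < \<delta>" for D \<delta>
    using that assms(2) partitionsD[OF that(1)] by (auto simp: mesh_less_iff) (meson le_less_trans subsetD)
  then show ?thesis
    using assms(1) unfolding has_BC_limit_def by meson
qed

text \<open>A single partition fine enough for both limits decides the matter; it exists because
  \<open>\<kappa>\<close> is nonatomic.\<close>

lemma has_BC_limit_unique:
  assumes \<kappa>: "\<kappa> \<in> NA_plus M" and E: "E \<in> sets M"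
    and L: "has_BC_limit M \<kappa> \<nu> E L" and L': "has_BC_limit M \<kappa> \<nu> E L'"
  shows "L = L'"
proof (rule ccontr)
  assume "L \<noteq> L'"
  then have e: "0 < \<bar>L - L'\<bar> / 2" by simp
  obtain \<delta> where \<delta>: "\<delta> > 0" "\<forall>D \<in> partitions M E. mesh \<kappa> D < \<delta> \<longrightarrow> \<bar>(\<Sum>I\<in>D. \<nu> I) - L\<bar> < \<bar>L - L'\<bar> / 2"
    using L e unfolding has_BC_limit_def by meson
  obtain \<delta>' where \<delta>': "\<delta>' > 0" "\<forall>D \<in> partitions M E. mesh \<kappa> D < \<delta>' \<longrightarrow> \<bar>(\<Sum>I\<in>D. \<nu> I) - L'\<bar> < \<bar>L - L'\<bar> / 2"
    using L' e unfolding has_BC_limit_def by meson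
  obtain D where D: "D \<in> partitions M E" "mesh \<kappa> D < min \<delta> \<delta>'"
    using NA_plus_fine_partition[OF \<kappa> E, of "min \<delta> \<delta>'"] \<delta> \<delta>' by auto
  then have "\<bar>(\<Sum>I\<in>D. \<nu> I) - L\<bar> < \<bar>L - L'\<bar> / 2" "\<bar>(\<Sum>I\<in>D. \<nu> I) - L'\<bar> < \<bar>L - L'\<bar> / 2"
    using \<delta> \<delta>' by auto
  then show False by argo
qed

text \<open>Both limits persist for \<open>\<kappa> + \<kappa>'\<close>. This makes the description
  in \<open>BC_integral\<close>, which leaves the control measure free, a proper one.\<close>

lemma has_BC_limit_unique':
  assumes \<kappa>: "\<kappa> \<in> NA_plus M" and \<kappa>': "\<kappa>' \<in> NA_plus M" and E: "E \<in> sets M"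
    and L: "has_BC_limit M \<kappa> \<nu> E L" and L': "has_BC_limit M \<kappa>' \<nu> E L'"
  shows "L = L'"
proof (rule has_BC_limit_unique[OF NA_plus_add[OF \<kappa> \<kappa>'] E])
  show "has_BC_limit M (\<lambda>A. \<kappa> A + \<kappa>' A) \<nu> E L"
    by (rule has_BC_limit_mono[OF L]) (use NA_plusD(5)[OF \<kappa>'] in auto)
  show "has_BC_limit M (\<lambda>A. \<kappa> A + \<kappa>' A) \<nu> E L'"
    by (rule has_BC_limit_mono[OF L']) (use NA_plusD(5)[OF \<kappa>] in auto)
qed

lemma has_BC_limit_add:
  assumes "has_BC_limit M \<kappa> \<nu> E L" "has_BC_limit M \<kappa> \<nu>' E L'"
  shows "has_BC_limit M \<kappa> (\<lambda>A. \<nu> A + \<nu>' A) E (L + L')"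
  unfolding has_BC_limit_def
proof (intro allI impI)
  fix \<epsilon> :: real assume "0 < \<epsilon>"
  then have e: "0 < \<epsilon> / 2" by simp
  obtain \<delta> where \<delta>: "\<delta> > 0" "\<forall>D \<in> partitions M E. mesh \<kappa> D < \<delta> \<longrightarrow> \<bar>(\<Sum>I\<in>D. \<nu> I) - L\<bar> < \<epsilon> / 2"
    using assms(1) e unfolding has_BC_limit_def by meson
  obtain \<delta>' where \<delta>': "\<delta>' > 0" "\<forall>D \<in> partitions M E. mesh \<kappa> D < \<delta>' \<longrightarrow> \<bar>(\<Sum>I\<in>D. \<nu>' I) - L'\<bar> < \<epsilon> / 2"
    using assms(2) e unfolding has_BC_limit_def by meson
  show "\<exists>\<delta>>0. \<forall>D\<in>partitions M E. mesh \<kappa> D < \<delta> \<longrightarrow> \<bar>(\<Sum>I\<in>D. \<nu> I + \<nu>' I) - (L + L')\<bar> < \<epsilon>"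
  proof (intro exI[of _ "min \<delta> \<delta>'"] conjI ballI impI)
    fix D assume "D \<in> partitions M E" "mesh \<kappa> D < min \<delta> \<delta>'"
    then have "\<bar>(\<Sum>I\<in>D. \<nu> I) - L\<bar> < \<epsilon> / 2" "\<bar>(\<Sum>I\<in>D. \<nu>' I) - L'\<bar> < \<epsilon> / 2"
      using \<delta>(2) \<delta>'(2) by auto
    then show "\<bar>(\<Sum>I\<in>D. \<nu> I + \<nu>' I) - (L + L')\<bar> < \<epsilon>"
      unfolding sum.distrib by argo
  qed (use \<delta> \<delta>' in auto)
qed

lemma has_BC_limit_cmult:
  assumes "has_BC_limit M \<kappa> \<nu> E L"
  shows "has_BC_limit M \<kappa> (\<lambda>A. c * \<nu> A) E (c * L)"
  unfolding has_BC_limit_def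
proof (intro allI impI)
  fix \<epsilon> :: real assume \<epsilon>: "0 < \<epsilon>"
  \<comment> \<open>The added 1 keeps the divisor positive when \<open>c = 0\<close>.\<close>
  then have "0 < \<epsilon> / (\<bar>c\<bar> + 1)" by simp
  then obtain \<delta> where \<delta>: "\<delta> > 0"
    "\<forall>D \<in> partitions M E. mesh \<kappa> D < \<delta> \<longrightarrow> \<bar>(\<Sum>I\<in>D. \<nu> I) - L\<bar> < \<epsilon> / (\<bar>c\<bar> + 1)"
    using assms unfolding has_BC_limit_def by meson
  have "\<bar>(\<Sum>I\<in>D. c * \<nu> I) - c * L\<bar> < \<epsilon>" if "D \<in> partitions M E" "mesh \<kappa> D < \<delta>" for D
  proof -
    have "\<bar>(\<Sum>I\<in>D. c * \<nu> I) - c * L\<bar> = \<bar>c\<bar> * \<bar>(\<Sum>I\<in>D. \<nu> I) - L\<bar>"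
      by (simp add: sum_distrib_left[symmetric] right_diff_distrib[symmetric] abs_mult)
    also have "\<dots> \<le> (\<bar>c\<bar> + 1) * \<bar>(\<Sum>I\<in>D. \<nu> I) - L\<bar>"
      by (intro mult_right_mono) auto
    also have "\<dots> < (\<bar>c\<bar> + 1) * (\<epsilon> / (\<bar>c\<bar> + 1))"
      using \<delta>(2) that by (intro mult_strict_left_mono) auto
    finally show ?thesis by simp
  qed
  then show "\<exists>\<delta>>0. \<forall>D\<in>partitions M E. mesh \<kappa> D < \<delta> \<longrightarrow> \<bar>(\<Sum>I\<in>D. c * \<nu> I) - c * L\<bar> < \<epsilon>"
    using \<delta>(1) by blast
qed

text \<open>A fine partition of \<open>A\<close> glued to one of \<open>B\<close> is a fine
  partition of the union, and its sum splits.\<close>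

lemma has_BC_limit_Un:
  assumes \<kappa>: "\<kappa> \<in> NA_plus M" and A: "A \<in> sets M" and B: "B \<in> sets M" and AB: "A \<inter> B = {}"
    and L: "has_BC_limit M \<kappa> \<nu> A L" and L': "has_BC_limit M \<kappa> \<nu> B L'"
    and K: "has_BC_limit M \<kappa> \<nu> (A \<union> B) K"
  shows "K = L + L'"
proof (rule ccontr)
  assume "K \<noteq> L + L'"
  \<comment> \<open>Three errors, for \<open>A\<close>, \<open>B\<close> and the union, must
    together stay below the supposed gap.\<close>
  define \<epsilon> where "\<epsilon> = \<bar>K - (L + L')\<bar> / 3"
  have \<epsilon>: "0 < \<epsilon>" using \<open>K \<noteq> L + L'\<close> by (simp add: \<epsilon>_def)
  obtain \<delta>1 where 1: "\<delta>1 > 0" "\<forall>D \<in> partitions M A. mesh \<kappa> D < \<delta>1 \<longrightarrow> \<bar>(\<Sum>I\<in>D. \<nu> I) - L\<bar> < \<epsilon>"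
    using L \<epsilon> unfolding has_BC_limit_def by meson
  obtain \<delta>2 where 2: "\<delta>2 > 0" "\<forall>D \<in> partitions M B. mesh \<kappa> D < \<delta>2 \<longrightarrow> \<bar>(\<Sum>I\<in>D. \<nu> I) - L'\<bar> < \<epsilon>"
    using L' \<epsilon> unfolding has_BC_limit_def by meson
  obtain \<delta>3 where 3: "\<delta>3 > 0" "\<forall>D \<in> partitions M (A \<union> B). mesh \<kappa> D < \<delta>3 \<longrightarrow> \<bar>(\<Sum>I\<in>D. \<nu> I) - K\<bar> < \<epsilon>"
    using K \<epsilon> unfolding has_BC_limit_def by meson
  define \<delta> where "\<delta> = min \<delta>1 (min \<delta>2 \<delta>3)"
  have \<delta>: "0 < \<delta>" "\<delta> \<le> \<delta>1" "\<delta> \<le> \<delta>2" "\<delta> \<le> \<delta>3" using 1 2 3 by (auto simp: \<delta>_def)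
  obtain D where D: "D \<in> partitions M A" "mesh \<kappa> D < \<delta>"
    using NA_plus_fine_partition[OF \<kappa> A \<delta>(1)] by blast
  obtain D' where D': "D' \<in> partitions M B" "mesh \<kappa> D' < \<delta>"
    using NA_plus_fine_partition[OF \<kappa> B \<delta>(1)] by blast
  note U = partitions_Un[OF D(1) D'(1) AB]
  have "mesh \<kappa> (D \<union> D') < \<delta>"
    using D D' partitionsD(1)[OF D(1)] partitionsD(1)[OF D'(1)] by (auto simp: mesh_less_iff)
  then have "\<bar>(\<Sum>I\<in>D \<union> D'. \<nu> I) - K\<bar> < \<epsilon>" using 3(2) U(1) \<delta> by auto
  moreover have "\<bar>(\<Sum>I\<in>D. \<nu> I) - L\<bar> < \<epsilon>" using 1(2) D \<delta> by auto
  moreover have "\<bar>(\<Sum>I\<in>D'. \<nu> I) - L'\<bar> < \<epsilon>" using 2(2) D' \<delta> by auto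
  ultimately have "\<bar>K - (L + L')\<bar> < 3 * \<epsilon>" unfolding U(2) by linarith
  then show False by (simp add: \<epsilon>_def)
qed

text \<open>
  Two fine partitions of a subset of \<open>E\<close> extend to \<open>E\<close> by the same partition of the complement,
  so the modulus \<open>\<delta>\<close> for \<open>E\<close> serves all subsets. The one-block partition then compares \<open>\<nu>\<close> with
  its integral on small sets.
\<close>
lemma has_BC_limit_uniform:
  assumes \<kappa>: "\<kappa> \<in> NA_plus M" and E: "E \<in> sets M" and L: "has_BC_limit M \<kappa> \<nu> E L"
    and "\<nu> {} = 0" "0 < \<epsilon>"
  obtains \<delta> where "0 < \<delta>"
    "\<And>A K. A \<in> sets M \<Longrightarrow> A \<subseteq> E \<Longrightarrow> has_BC_limit M \<kappa> \<nu> A K \<Longrightarrow> \<kappa> A < \<delta> \<Longrightarrow> \<bar>\<nu> A - K\<bar> < \<epsilon>"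
proof -
  have e: "0 < \<epsilon> / 3" using assms by simp
  then obtain \<delta> where \<delta>: "\<delta> > 0" "\<forall>D \<in> partitions M E. mesh \<kappa> D < \<delta> \<longrightarrow> \<bar>(\<Sum>I\<in>D. \<nu> I) - L\<bar> < \<epsilon> / 3"
    using L unfolding has_BC_limit_def by meson
  have "\<bar>\<nu> A - K\<bar> < \<epsilon>"
    if A: "A \<in> sets M" "A \<subseteq> E" "has_BC_limit M \<kappa> \<nu> A K" "\<kappa> A < \<delta>" for A K
  proof -
    \<comment> \<open>\<open>\<delta>'\<close> depends on \<open>A\<close>, but only the auxiliary
      partition \<open>D\<close> has to respect it; the condition on \<open>A\<close> itself
      involves \<open>\<delta>\<close> alone.\<close>
    obtain \<delta>' where \<delta>': "\<delta>' > 0" "\<forall>D \<in> partitions M A. mesh \<kappa> D < \<delta>' \<longrightarrow> \<bar>(\<Sum>I\<in>D. \<nu> I) - K\<bar> < \<epsilon> / 3"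
      using A(3) e unfolding has_BC_limit_def by meson
    obtain D where D: "D \<in> partitions M A" "mesh \<kappa> D < min \<delta> \<delta>'"
      using NA_plus_fine_partition[OF \<kappa> A(1), of "min \<delta> \<delta>'"] \<delta> \<delta>' by auto
    have "E - A \<in> sets M" using E A by auto
    from NA_plus_fine_partition[OF \<kappa> this \<delta>(1)]
    obtain C where C: "C \<in> partitions M (E - A)" "mesh \<kappa> C < \<delta>" by blast
    have *: "\<bar>(\<Sum>I\<in>D. \<nu> I) + (\<Sum>I\<in>C. \<nu> I) - L\<bar> < \<epsilon> / 3" if D: "D \<in> partitions M A" "mesh \<kappa> D < \<delta>" for D
    proof -
      have "A \<inter> (E - A) = {}" "A \<union> (E - A) = E" using A by auto
      note U = partitions_Un[OF D(1) C(1) this(1), unfolded this(2)]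
      have "mesh \<kappa> (D \<union> C) < \<delta>"
        using D C partitionsD(1)[OF D(1)] partitionsD(1)[OF C(1)] by (auto simp: mesh_less_iff)
      then show ?thesis using \<delta>(2) U by metis
    qed
    \<comment> \<open>Blocks are nonempty, so for \<open>A = {}\<close> the partition is empty and
      its sum agrees with \<open>\<nu> A\<close> because \<open>\<nu> {} = 0\<close>.\<close>
    let ?A = "if A = {} then {} else {A}"
    have "\<bar>(\<Sum>I\<in>?A. \<nu> I) + (\<Sum>I\<in>C. \<nu> I) - L\<bar> < \<epsilon> / 3"
      using A(4) \<delta>(1) by (intro * partitions_singleton A(1)) (auto simp: mesh_less_iff)
    moreover have "(\<Sum>I\<in>?A. \<nu> I) = \<nu> A" using assms(4) by simp
    moreover have "\<bar>(\<Sum>I\<in>D. \<nu> I) + (\<Sum>I\<in>C. \<nu> I) - L\<bar> < \<epsilon> / 3"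
      using D by (intro *) auto
    moreover have "\<bar>(\<Sum>I\<in>D. \<nu> I) - K\<bar> < \<epsilon> / 3"
      using \<delta>'(2) D by auto
    ultimately show ?thesis by linarith
  qed
  then show ?thesis using \<delta>(1) that by blast
qed

section \<open>The integral as an operator on \<open>BC\<close>\<close>

lemma BC_integral_eq:
  assumes "\<kappa> \<in> NA_plus M" "BC_integrable M \<kappa> \<nu>" "E \<in> sets M" "has_BC_limit M \<kappa> \<nu> E L"
  shows "BC_integral M \<nu> E = L"
proof -
  have "(THE L. \<exists>\<kappa>\<in>NA_plus M. BC_integrable M \<kappa> \<nu> \<and> has_BC_limit M \<kappa> \<nu> E L) = L"
  proof (rule the_equality)
    show "\<exists>\<kappa>\<in>NA_plus M. BC_integrable M \<kappa> \<nu> \<and> has_BC_limit M \<kappa> \<nu> E L"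
      using assms by blast
    show "L' = L" if "\<exists>\<kappa>\<in>NA_plus M. BC_integrable M \<kappa> \<nu> \<and> has_BC_limit M \<kappa> \<nu> E L'" for L'
      using that has_BC_limit_unique'[OF _ assms(1,3) _ assms(4)] by blast
  qed
  then show ?thesis using assms(3) by (simp add: BC_integral_def)
qed

lemma has_BC_limit_BC_integral:
  assumes "\<kappa> \<in> NA_plus M" "BC_integrable M \<kappa> \<nu>" "E \<in> sets M"
  shows "has_BC_limit M \<kappa> \<nu> E (BC_integral M \<nu> E)"
proof -
  obtain L where L: "has_BC_limit M \<kappa> \<nu> E L"
    using assms(2,3) unfolding BC_integrable_def by blast
  then show ?thesis unfolding BC_integral_eq[OF assms L] .
qed

lemma BC_integral_outside: "E \<notin> sets M \<Longrightarrow> BC_integral M \<nu> E = 0"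
  by (simp add: BC_integral_def)

text \<open>Monotonicity and \<open>\<nu> {} = 0\<close> make all partition sums nonnegative; a
  negative limit, with its own absolute value as tolerance, would force some sum below 0.\<close>

lemma BC_integral_nonneg:
  assumes "\<nu> \<in> BC M" "monotone_game M \<nu>" "E \<in> sets M"
  shows "0 \<le> BC_integral M \<nu> E"
proof (rule ccontr)
  assume "\<not> 0 \<le> BC_integral M \<nu> E"
  then have neg: "0 < - BC_integral M \<nu> E" by simp
  obtain \<kappa> where \<kappa>: "\<kappa> \<in> NA_plus M" "BC_integrable M \<kappa> \<nu>" using assms(1) by (auto simp: BC_def)
  from has_BC_limit_BC_integral[OF this assms(3)] neg obtain \<delta> where \<delta>: "\<delta> > 0"
    "\<forall>D\<in>partitions M E. mesh \<kappa> D < \<delta> \<longrightarrow> \<bar>(\<Sum>I\<in>D. \<nu> I) - BC_integral M \<nu> E\<bar> < - BC_integral M \<nu> E"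
    unfolding has_BC_limit_def by meson
  obtain D where D: "D \<in> partitions M E" "mesh \<kappa> D < \<delta>"
    using NA_plus_fine_partition[OF \<kappa>(1) assms(3) \<delta>(1)] by blast
  have "0 \<le> \<nu> I" if "I \<in> D" for I
    using assms(1,2) partitionsD(2)[OF D(1)] that mono_onD[of "sets M" \<nu> "{}" I]
    by (auto simp: BC_def game_def monotone_game_def)
  then have "0 \<le> (\<Sum>I\<in>D. \<nu> I)" by (rule sum_nonneg)
  moreover have "\<bar>(\<Sum>I\<in>D. \<nu> I) - BC_integral M \<nu> E\<bar> < - BC_integral M \<nu> E" using \<delta>(2) D by blast
  ultimately show False by linarith
qed

lemma has_BC_limit_signed_measure:
  assumes "signed_measure M \<nu>"
  shows "has_BC_limit M \<kappa> \<nu> E (\<nu> E)"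
proof -
  have "(\<Sum>I\<in>D. \<nu> I) = \<nu> E" if "D \<in> partitions M E" for D
    using signed_measure_Union[OF assms, of D] partitionsD[OF that] by simp
  then show ?thesis unfolding has_BC_limit_def by (auto intro: exI[of _ 1])
qed

lemma BC_integral_signed_measure:
  assumes "signed_measure M \<nu>"
  shows "BC_integral M \<nu> = \<nu>"
proof
  fix E
  show "BC_integral M \<nu> E = \<nu> E"
  proof (cases "E \<in> sets M")
    case True
    \<comment> \<open>All partition sums already equal the limit, so even the zero measure serves as
      control.\<close>
    have "BC_integrable M (\<lambda>A. 0) \<nu>"
      using has_BC_limit_signed_measure[OF assms] by (auto simp: BC_integrable_def)
    then show ?thesis
      using BC_integral_eq[OF zero_NA_plus _ True has_BC_limit_signed_measure[OF assms]] by blast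
  next
    case False
    then show ?thesis using assms by (auto simp: signed_measure_def game_def BC_integral_outside)
  qed
qed

lemma BC_add:
  assumes "\<nu> \<in> BC M" "\<nu>' \<in> BC M"
  shows "(\<lambda>A. \<nu> A + \<nu>' A) \<in> BC M"
    and "BC_integral M (\<lambda>A. \<nu> A + \<nu>' A) = (\<lambda>A. BC_integral M \<nu> A + BC_integral M \<nu>' A)"
proof -
  obtain \<kappa> where \<kappa>: "\<kappa> \<in> NA_plus M" "BC_integrable M \<kappa> \<nu>" using assms by (auto simp: BC_def)
  obtain \<kappa>' where \<kappa>': "\<kappa>' \<in> NA_plus M" "BC_integrable M \<kappa>' \<nu>'" using assms by (auto simp: BC_def)
  let ?\<kappa> = "\<lambda>A. \<kappa> A + \<kappa>' A"
  \<comment> \<open>The two games may come with different control measures; both limits are first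
    moved to the sum.\<close>
  have lim: "has_BC_limit M ?\<kappa> (\<lambda>A. \<nu> A + \<nu>' A) E (BC_integral M \<nu> E + BC_integral M \<nu>' E)"
    if E: "E \<in> sets M" for E
    using has_BC_limit_BC_integral[OF \<kappa> E] has_BC_limit_BC_integral[OF \<kappa>' E]
      NA_plusD(5)[OF \<kappa>(1)] NA_plusD(5)[OF \<kappa>'(1)]
    by (auto intro!: has_BC_limit_add elim!: has_BC_limit_mono)
  then have int: "BC_integrable M ?\<kappa> (\<lambda>A. \<nu> A + \<nu>' A)" by (auto simp: BC_integrable_def)
  then show "(\<lambda>A. \<nu> A + \<nu>' A) \<in> BC M"
    using assms NA_plus_add[OF \<kappa>(1) \<kappa>'(1)] by (auto simp: BC_def game_def)
  show "BC_integral M (\<lambda>A. \<nu> A + \<nu>' A) = (\<lambda>A. BC_integral M \<nu> A + BC_integral M \<nu>' A)"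
  proof
    fix E
    show "BC_integral M (\<lambda>A. \<nu> A + \<nu>' A) E = BC_integral M \<nu> E + BC_integral M \<nu>' E"
      using BC_integral_eq[OF NA_plus_add[OF \<kappa>(1) \<kappa>'(1)] int _ lim]
      by (cases "E \<in> sets M") (auto simp: BC_integral_outside)
  qed
qed

lemma BC_cmult:
  assumes "\<nu> \<in> BC M"
  shows "(\<lambda>A. c * \<nu> A) \<in> BC M"
    and "BC_integral M (\<lambda>A. c * \<nu> A) = (\<lambda>A. c * BC_integral M \<nu> A)"
proof -
  obtain \<kappa> where \<kappa>: "\<kappa> \<in> NA_plus M" "BC_integrable M \<kappa> \<nu>" using assms by (auto simp: BC_def)
  have lim: "has_BC_limit M \<kappa> (\<lambda>A. c * \<nu> A) E (c * BC_integral M \<nu> E)" if "E \<in> sets M" for E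
    using has_BC_limit_BC_integral[OF \<kappa> that] by (rule has_BC_limit_cmult)
  then have int: "BC_integrable M \<kappa> (\<lambda>A. c * \<nu> A)" by (auto simp: BC_integrable_def)
  then show "(\<lambda>A. c * \<nu> A) \<in> BC M"
    using assms \<kappa> by (auto simp: BC_def game_def)
  show "BC_integral M (\<lambda>A. c * \<nu> A) = (\<lambda>A. c * BC_integral M \<nu> A)"
  proof
    fix E
    show "BC_integral M (\<lambda>A. c * \<nu> A) E = c * BC_integral M \<nu> E"
      using BC_integral_eq[OF \<kappa>(1) int _ lim]
      by (cases "E \<in> sets M") (auto simp: BC_integral_outside)
  qed
qed

section \<open>Absolutely continuous games\<close>

lemma subchainD:
  assumes "subchain M \<Lambda>" "(S, T) \<in> \<Lambda>"
  shows "S \<in> sets M" "T \<in> sets M" "S \<subseteq> T"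
proof -
  obtain C where C: "chain_of M C" "\<Lambda> \<subseteq> links C" using assms by (auto simp: subchain_def)
  then obtain i where i: "Suc i < length C" "S = C ! i" "T = C ! Suc i"
    using assms(2) by (auto simp: links_def)
  then have "C ! i \<in> set C" "C ! Suc i \<in> set C" by auto
  then show "S \<in> sets M" "T \<in> sets M" "S \<subseteq> T"
    using C i by (auto simp: chain_of_def)
qed

text \<open>The increments of \<open>\<mu>\<close> and \<open>\<rho>\<close> along a link are
  nonnegative, so adding \<open>\<rho>\<close> only enlarges them.\<close>

lemma variation_NA_plus_le:
  assumes \<mu>: "\<mu> \<in> NA_plus M" and \<mu>': "\<mu>' \<in> NA_plus M" and "subchain M \<Lambda>"
    and le: "\<And>A. A \<in> sets M \<Longrightarrow> \<mu>' A = \<mu> A + \<rho> A" and \<rho>: "\<rho> \<in> NA_plus M"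
  shows "variation \<mu> \<Lambda> \<le> variation \<mu>' \<Lambda>"
  unfolding variation_def
proof (rule sum_mono, clarify)
  fix S T assume "(S, T) \<in> \<Lambda>"
  note * = subchainD[OF assms(3) this]
  show "\<bar>\<mu> T - \<mu> S\<bar> \<le> \<bar>\<mu>' T - \<mu>' S\<bar>"
    using NA_plus_mono[OF \<mu> *] NA_plus_mono[OF \<rho> *] le[OF *(1)] le[OF *(2)] by linarith
qed

lemma AC4_add:
  assumes "\<nu> \<in> AC4 M" "\<nu>' \<in> AC4 M"
  shows "(\<lambda>A. \<nu> A + \<nu>' A) \<in> AC4 M"
proof -
  obtain \<mu> where \<mu>: "\<mu> \<in> NA_plus M" "abs_cont4 M \<nu> \<mu>" using assms by (auto simp: AC4_def)
  obtain \<mu>' where \<mu>': "\<mu>' \<in> NA_plus M" "abs_cont4 M \<nu>' \<mu>'" using assms by (auto simp: AC4_def)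
  let ?\<mu> = "\<lambda>A. \<mu> A + \<mu>' A"
  note s = NA_plus_add[OF \<mu>(1) \<mu>'(1)]
  have "abs_cont4 M (\<lambda>A. \<nu> A + \<nu>' A) ?\<mu>"
    unfolding abs_cont4_def
  proof (intro allI impI)
    fix \<epsilon> :: real assume "0 < \<epsilon>"
    then have e: "0 < \<epsilon> / 2" by simp
    obtain \<delta> where \<delta>: "\<delta> > 0" "\<forall>\<Lambda>. subchain M \<Lambda> \<longrightarrow> variation \<mu> \<Lambda> < \<delta> \<longrightarrow> variation \<nu> \<Lambda> < \<epsilon> / 2"
      using \<mu>(2) e unfolding abs_cont4_def by meson
    obtain \<delta>' where \<delta>': "\<delta>' > 0" "\<forall>\<Lambda>. subchain M \<Lambda> \<longrightarrow> variation \<mu>' \<Lambda> < \<delta>' \<longrightarrow> variation \<nu>' \<Lambda> < \<epsilon> / 2"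
      using \<mu>'(2) e unfolding abs_cont4_def by meson
    show "\<exists>\<delta>>0. \<forall>\<Lambda>. subchain M \<Lambda> \<longrightarrow> variation ?\<mu> \<Lambda> < \<delta> \<longrightarrow> variation (\<lambda>A. \<nu> A + \<nu>' A) \<Lambda> < \<epsilon>"
    proof (intro exI[of _ "min \<delta> \<delta>'"] conjI allI impI)
      fix \<Lambda> assume \<Lambda>: "subchain M \<Lambda>" "variation ?\<mu> \<Lambda> < min \<delta> \<delta>'"
      have "variation \<mu> \<Lambda> \<le> variation ?\<mu> \<Lambda>" "variation \<mu>' \<Lambda> \<le> variation ?\<mu> \<Lambda>"
        by (rule variation_NA_plus_le[OF \<mu>(1) s \<Lambda>(1) _ \<mu>'(1)], simp)
           (rule variation_NA_plus_le[OF \<mu>'(1) s \<Lambda>(1) _ \<mu>(1)], simp)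
      then have "variation \<nu> \<Lambda> < \<epsilon> / 2" "variation \<nu>' \<Lambda> < \<epsilon> / 2"
        using \<Lambda> \<delta>(2) \<delta>'(2) by auto
      moreover have "variation (\<lambda>A. \<nu> A + \<nu>' A) \<Lambda> \<le> variation \<nu> \<Lambda> + variation \<nu>' \<Lambda>"
        unfolding variation_def sum.distrib[symmetric] by (rule sum_mono) auto
      ultimately show "variation (\<lambda>A. \<nu> A + \<nu>' A) \<Lambda> < \<epsilon>" by linarith
    qed (use \<delta> \<delta>' in auto)
  qed
  then show ?thesis using assms s by (auto simp: AC4_def game_def)
qed

lemma AC4_cmult:
  assumes "\<nu> \<in> AC4 M"
  shows "(\<lambda>A. c * \<nu> A) \<in> AC4 M"
proof -
  obtain \<mu> where \<mu>: "\<mu> \<in> NA_plus M" "abs_cont4 M \<nu> \<mu>" using assms by (auto simp: AC4_def)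
  \<comment> \<open>The factor exceeds \<open>\<bar>c\<bar>\<close> so that it can be divided by
    even when \<open>c = 0\<close>.\<close>
  have var: "variation (\<lambda>A. c * \<nu> A) \<Lambda> \<le> (\<bar>c\<bar> + 1) * variation \<nu> \<Lambda>" for \<Lambda>
  proof -
    have "variation (\<lambda>A. c * \<nu> A) \<Lambda> = \<bar>c\<bar> * variation \<nu> \<Lambda>"
      by (simp add: variation_def sum_distrib_left case_prod_unfold right_diff_distrib[symmetric] abs_mult)
    also have "\<dots> \<le> (\<bar>c\<bar> + 1) * variation \<nu> \<Lambda>"
      by (intro mult_right_mono) (auto simp: variation_def intro!: sum_nonneg)
    finally show ?thesis .
  qed
  have "abs_cont4 M (\<lambda>A. c * \<nu> A) \<mu>"
    unfolding abs_cont4_def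
  proof (intro allI impI)
    fix \<epsilon> :: real assume "0 < \<epsilon>"
    then have "0 < \<epsilon> / (\<bar>c\<bar> + 1)" by simp
    then obtain \<delta> where \<delta>: "\<delta> > 0"
      "\<forall>\<Lambda>. subchain M \<Lambda> \<longrightarrow> variation \<mu> \<Lambda> < \<delta> \<longrightarrow> variation \<nu> \<Lambda> < \<epsilon> / (\<bar>c\<bar> + 1)"
      using \<mu>(2) unfolding abs_cont4_def by meson
    have "variation (\<lambda>A. c * \<nu> A) \<Lambda> < \<epsilon>" if "variation \<nu> \<Lambda> < \<epsilon> / (\<bar>c\<bar> + 1)" for \<Lambda>
    proof -
      have "(\<bar>c\<bar> + 1) * variation \<nu> \<Lambda> < (\<bar>c\<bar> + 1) * (\<epsilon> / (\<bar>c\<bar> + 1))"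
        using that by (intro mult_strict_left_mono) auto
      also have "\<dots> = \<epsilon>" by simp
      finally show ?thesis using var[of \<Lambda>] by linarith
    qed
    then show "\<exists>\<delta>>0. \<forall>\<Lambda>. subchain M \<Lambda> \<longrightarrow> variation \<mu> \<Lambda> < \<delta> \<longrightarrow> variation (\<lambda>A. c * \<nu> A) \<Lambda> < \<epsilon>"
      using \<delta> by blast
  qed
  then show ?thesis using assms \<mu> by (auto simp: AC4_def game_def)
qed

text \<open>The sets interleave into one increasing sequence in which the links
  \<open>(A i, B i)\<close> are every second step. A subchain is a set of links, so equal pairs
  merge; the indexed sum survives because a repeated pair is degenerate and contributes 0.\<close>

lemma subchain_alternating:
  fixes A B :: "nat \<Rightarrow> 'a set"
  assumes sets: "\<And>i. A i \<in> sets M" "\<And>i. B i \<in> sets M"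
    and sub: "\<And>i. A i \<subseteq> B i" "\<And>i. B i \<subseteq> A (Suc i)"
  shows "subchain M ((\<lambda>i. (A i, B i)) ` {..<m})"
    and "variation \<nu> ((\<lambda>i. (A i, B i)) ` {..<m}) = (\<Sum>i<m. \<bar>\<nu> (B i) - \<nu> (A i)\<bar>)"
proof -
  define G where "G n = (if even n then A (n div 2) else B (n div 2))" for n
  have G_sets: "G n \<in> sets M" for n using sets by (simp add: G_def)
  have G_Suc: "G n \<subseteq> G (Suc n)" for n
    using sub by (auto simp: G_def elim!: evenE oddE)
  \<comment> \<open>The leading \<open>{}\<close> shifts indices by one: \<open>G n\<close> sits at
    position \<open>Suc n\<close>, and the link \<open>(A i, B i)\<close> starts at
    \<open>Suc (2 * i)\<close>.\<close>
  define C where "C = {} # map G [0..<2 * m] @ [space M]"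
  have len: "length C = 2 * m + 2" by (simp add: C_def)
  have nth: "C ! Suc n = (if n < 2 * m then G n else space M)" if "n \<le> 2 * m" for n
    using that by (auto simp: C_def nth_append)
  have "C ! i \<subseteq> C ! Suc i" if "Suc i < length C" for i
  proof (cases i)
    case 0
    then show ?thesis by (simp add: C_def)
  next
    case (Suc n)
    then show ?thesis
      using that len nth[of n] nth[of "Suc n"] G_Suc[of n] sets.sets_into_space[OF G_sets[of n]] by auto
  qed
  moreover have "set C \<subseteq> sets M" using G_sets by (auto simp: C_def)
  ultimately have chain: "chain_of M C"
    by (simp add: chain_of_def C_def)
  have "(A i, B i) \<in> links C" if "i < m" for i
    unfolding links_def
    using that len nth[of "2 * i"] nth[of "Suc (2 * i)"]
    by (auto simp: G_def intro!: exI[of _ "Suc (2 * i)"])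
  then show "subchain M ((\<lambda>i. (A i, B i)) ` {..<m})"
    using chain by (auto simp: subchain_def)
  have mono: "A i \<subseteq> A j" if "i \<le> j" for i j
    using that by (rule lift_Suc_mono_le[rotated]) (use sub in blast)
  \<comment> \<open>If the pair recurs at a later index \<open>j\<close>, then
    \<open>B i \<subseteq> A j = A i\<close>.\<close>
  have deg: "A i = B i" if "A i = A j" "B i = B j" "i \<noteq> j" for i j
  proof -
    have "B i \<subseteq> A j" if "Suc i \<le> j" for i j using sub(2)[of i] mono[OF that] by blast
    then show ?thesis
      using that sub(1)[of i] by (metis Suc_leI linorder_neqE_nat subset_antisym)
  qed
  show "variation \<nu> ((\<lambda>i. (A i, B i)) ` {..<m}) = (\<Sum>i<m. \<bar>\<nu> (B i) - \<nu> (A i)\<bar>)"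
    unfolding variation_def
  proof (subst sum.reindex_nontrivial)
    fix i j assume "i \<noteq> j" "(A i, B i) = (A j, B j)"
    with deg[of j i] show "(case (A i, B i) of (S, T) \<Rightarrow> \<bar>\<nu> T - \<nu> S\<bar>) = 0" by simp
  qed auto
qed

lemma abs_cont4_small:
  assumes "abs_cont4 M \<nu> \<mu>" "\<nu> {} = 0" "\<mu> \<in> NA_plus M" "0 < \<epsilon>"
  obtains \<delta> where "0 < \<delta>" "\<And>A. A \<in> sets M \<Longrightarrow> \<mu> A < \<delta> \<Longrightarrow> \<bar>\<nu> A\<bar> < \<epsilon>"
proof -
  obtain \<delta> where \<delta>: "\<delta> > 0" "\<forall>\<Lambda>. subchain M \<Lambda> \<longrightarrow> variation \<mu> \<Lambda> < \<delta> \<longrightarrow> variation \<nu> \<Lambda> < \<epsilon>"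
    using assms unfolding abs_cont4_def by meson
  have "\<bar>\<nu> A\<bar> < \<epsilon>" if A: "A \<in> sets M" "\<mu> A < \<delta>" for A
  proof -
    \<comment> \<open>The alternating sequences are infinite, so \<open>F\<close> is continued
      constantly; with \<open>m = 1\<close> only the link from \<open>{}\<close> to \<open>A\<close>
      counts.\<close>
    define F where "F i = (if i = 0 then {} else A)" for i :: nat
    have F: "F 0 = {}" "F (Suc i) = A" "F i \<in> sets M" "F i \<subseteq> A" for i using A by (auto simp: F_def)
    note s = subchain_alternating[where A = F and M = M and B = "\<lambda>_. A" and m = 1]
    have "subchain M ((\<lambda>i. (F i, A)) ` {..<1})"
      "\<And>\<nu>. variation \<nu> ((\<lambda>i. (F i, A)) ` {..<1}) = \<bar>\<nu> A - \<nu> {}\<bar>"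
      using s F A by auto
    then show ?thesis
      using \<delta>(2) A assms(2) NA_plusD(3,5)[OF assms(3)] by (metis abs_of_nonneg diff_zero)
  qed
  then show ?thesis using \<delta>(1) that by blast
qed

text \<open>
  Every link of a chain is split along a partition \<open>P 0, \<dots>, P (k - 1)\<close> of the whole space into
  small sets. The \<open>j\<close>-th pieces of all links form a subchain of \<open>\<mu>\<close>-variation \<open>\<mu> (P j)\<close>.
\<close>
lemma AC4_subset_BV: "AC4 M \<subseteq> BV M"
proof
  fix \<nu> assume "\<nu> \<in> AC4 M"
  then obtain \<mu> where game: "game M \<nu>" and \<mu>: "\<mu> \<in> NA_plus M" and ac: "abs_cont4 M \<nu> \<mu>"
    by (auto simp: AC4_def)
  note \<mu>D = NA_plusD[OF \<mu>]
  \<comment> \<open>With tolerance 1, each block of the partition below accounts for variation less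
    than 1. The number of blocks then bounds the total variation uniformly in the chain.\<close>
  obtain \<delta> where \<delta>: "\<delta> > 0" "\<forall>\<Lambda>. subchain M \<Lambda> \<longrightarrow> variation \<mu> \<Lambda> < \<delta> \<longrightarrow> variation \<nu> \<Lambda> < 1"
    using ac unfolding abs_cont4_def by (meson zero_less_one)
  obtain D where D: "D \<in> partitions M (space M)" "mesh \<mu> D < \<delta>"
    using NA_plus_fine_partition[OF \<mu> sets.top \<delta>(1)] by blast
  note DD = partitionsD[OF D(1)]
  define k where "k = card D"
  obtain P where P: "bij_betw P {..<k} D"
    using ex_bij_betw_nat_finite[OF DD(1)] by (auto simp: k_def atLeast0LessThan)
  define Q where "Q j = (\<Union>l<j. P l)" for j
  have P_D: "P l \<in> D" if "l < k" for l using P that by (auto simp: bij_betw_def)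
  have P_sets: "P l \<in> sets M" if "l < k" for l using P_D[OF that] DD(2) by auto
  have Q_sets: "Q j \<in> sets M" if "j \<le> k" for j
    unfolding Q_def using that P_sets by (intro sets.finite_UN) auto
  have Q_Suc: "Q (Suc j) = Q j \<union> P j" for j by (auto simp: Q_def lessThan_Suc)
  have Q_k: "Q k = space M" using P DD(4) by (simp add: Q_def bij_betw_def)
  have "variation \<nu> (links C) \<le> real k" if C: "chain_of M C" for C
  proof -
    define m where "m = length C - 1"
    \<comment> \<open>The chain is continued constantly beyond its last set, giving an increasing
      sequence over all indices.\<close>
    define S where "S i = C ! min i m" for i
    have C_len: "length C = Suc m" using C by (cases C) (auto simp: chain_of_def m_def)
    have S_sets: "S i \<in> sets M" for i
    proof -
      have "S i \<in> set C" unfolding S_def using C_len by (intro nth_mem) auto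
      then show ?thesis using C by (auto simp: chain_of_def)
    qed
    have S_Suc: "S i \<subseteq> S (Suc i)" for i
      using C C_len by (cases "i < m") (auto simp: S_def chain_of_def)
    \<comment> \<open>\<open>X\<close> moves from \<open>S i\<close> at \<open>j = 0\<close> to
      \<open>S (Suc i)\<close> at \<open>j = k\<close> by adding one block at a time. For fixed
      \<open>j\<close> the pairs interleave, since
      \<open>X (Suc j) i \<subseteq> S (Suc i) \<subseteq> X j (Suc i)\<close>.\<close>
    define X where "X j i = S i \<union> (S (Suc i) \<inter> Q j)" for j i
    have X_sets: "X j i \<in> sets M" if "j \<le> k" for j i
      using S_sets Q_sets[OF that] by (auto simp: X_def)
    have X_sub: "X j i \<subseteq> X (Suc j) i" "X (Suc j) i \<subseteq> X j (Suc i)" for j i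
      using S_Suc[of i] S_Suc[of "Suc i"] by (auto simp: X_def Q_Suc)
    have col: "(\<Sum>i<m. \<bar>\<nu> (X (Suc j) i) - \<nu> (X j i)\<bar>) < 1" if j: "j < k" for j
    proof -
      let ?\<Lambda> = "(\<lambda>i. (X j i, X (Suc j) i)) ` {..<m}"
      have sets: "X j i \<in> sets M" "X (Suc j) i \<in> sets M" for i using X_sets j by auto
      have sub: "subchain M ?\<Lambda>"
        by (rule subchain_alternating(1)) (fact sets X_sub)+
      have var: "variation \<rho> ?\<Lambda> = (\<Sum>i<m. \<bar>\<rho> (X (Suc j) i) - \<rho> (X j i)\<bar>)" for \<rho>
        by (rule subchain_alternating(2)) (fact sets X_sub)+
      \<comment> \<open>The increment only adds points of \<open>P j\<close> that lie in
        \<open>S (Suc i)\<close> but not in \<open>S i\<close>. This form of the bound telescopes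
        over \<open>i\<close>.\<close>
      have le: "\<bar>\<mu> (X (Suc j) i) - \<mu> (X j i)\<bar> \<le> \<mu> (S (Suc i) \<inter> P j) - \<mu> (S i \<inter> P j)" for i
      proof -
        have "\<bar>\<mu> (X (Suc j) i) - \<mu> (X j i)\<bar> = \<mu> (X (Suc j) i - X j i)"
          using signed_measure_Diff[OF \<mu>D(1) sets(2,1) X_sub(1)] NA_plus_mono[OF \<mu> sets X_sub(1)] by simp
        also have "\<dots> \<le> \<mu> (S (Suc i) \<inter> P j - S i \<inter> P j)"
          using sets S_sets P_sets[OF j] by (intro NA_plus_mono[OF \<mu>]) (auto simp: X_def Q_Suc)
        also have "\<dots> = \<mu> (S (Suc i) \<inter> P j) - \<mu> (S i \<inter> P j)"
          using S_sets P_sets[OF j] S_Suc by (intro signed_measure_Diff[OF \<mu>D(1)]) auto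
        finally show ?thesis .
      qed
      have "(\<Sum>i<m. \<bar>\<mu> (X (Suc j) i) - \<mu> (X j i)\<bar>) \<le> (\<Sum>i<m. \<mu> (S (Suc i) \<inter> P j) - \<mu> (S i \<inter> P j))"
        by (rule sum_mono) (rule le)
      also have "\<dots> = \<mu> (S m \<inter> P j) - \<mu> (S 0 \<inter> P j)"
        by (rule sum_lessThan_telescope)
      also have "\<dots> \<le> \<mu> (P j)"
        using NA_plus_mono[OF \<mu>, of "S m \<inter> P j" "P j"] \<mu>D(5)[of "S 0 \<inter> P j"] S_sets P_sets[OF j] by force
      also have "\<dots> < \<delta>"
        using D(2) DD(1) P_D[OF j] by (auto simp: mesh_less_iff)
      finally show ?thesis
        using \<delta>(2) sub unfolding var[symmetric] by blast
    qed
    have row: "\<bar>\<nu> (S (Suc i)) - \<nu> (S i)\<bar> \<le> (\<Sum>j<k. \<bar>\<nu> (X (Suc j) i) - \<nu> (X j i)\<bar>)" for i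
    proof -
      have "X k i = S (Suc i)" "X 0 i = S i"
        using S_Suc[of i] Q_k sets.sets_into_space[OF S_sets[of "Suc i"]] by (auto simp: X_def Q_def)
      then have "\<nu> (S (Suc i)) - \<nu> (S i) = (\<Sum>j<k. \<nu> (X (Suc j) i) - \<nu> (X j i))"
        using sum_lessThan_telescope[of "\<lambda>j. \<nu> (X j i)" k] by simp
      then show ?thesis by (metis sum_abs)
    qed
    \<comment> \<open>Repeated sets in \<open>C\<close> can merge degenerate links; the alternating
      lemma with \<open>B i = A (Suc i)\<close> still gives the indexed sum.\<close>
    have "links C = (\<lambda>i. (S i, S (Suc i))) ` {..<m}"
      using C_len by (auto simp: links_def S_def image_iff Bex_def min_def) 
    then have "variation \<nu> (links C) = (\<Sum>i<m. \<bar>\<nu> (S (Suc i)) - \<nu> (S i)\<bar>)"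
      using subchain_alternating(2)[of S M "\<lambda>i. S (Suc i)" \<nu> m] S_sets S_Suc by simp
    also have "\<dots> \<le> (\<Sum>i<m. \<Sum>j<k. \<bar>\<nu> (X (Suc j) i) - \<nu> (X j i)\<bar>)"
      by (rule sum_mono) (rule row)
    also have "\<dots> = (\<Sum>j<k. \<Sum>i<m. \<bar>\<nu> (X (Suc j) i) - \<nu> (X j i)\<bar>)"
      by (rule sum.swap)
    also have "\<dots> \<le> (\<Sum>j<k. 1)"
      using col by (intro sum_mono less_imp_le) auto
    finally show ?thesis by simp
  qed
  then show "\<nu> \<in> BV M"
    using game by (auto simp: BV_def bdd_above_def)
qed

section \<open>The integral is a nonatomic measure\<close>

lemma BC_integral_small:
  assumes "\<nu> \<in> BC M" "\<nu> \<in> AC4 M"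
  obtains \<sigma> where "\<sigma> \<in> NA_plus M"
    "\<And>\<epsilon>. 0 < \<epsilon> \<Longrightarrow> \<exists>\<delta>>0. \<forall>A\<in>sets M. \<sigma> A < \<delta> \<longrightarrow> \<bar>BC_integral M \<nu> A\<bar> < \<epsilon>"
proof -
  obtain \<kappa> where \<kappa>: "\<kappa> \<in> NA_plus M" "BC_integrable M \<kappa> \<nu>" using assms by (auto simp: BC_def)
  obtain \<mu> where \<mu>: "\<mu> \<in> NA_plus M" "abs_cont4 M \<nu> \<mu>" using assms by (auto simp: AC4_def)
  have \<nu>0: "\<nu> {} = 0" using assms by (auto simp: BC_def game_def)
  have "\<exists>\<delta>>0. \<forall>A\<in>sets M. \<kappa> A + \<mu> A < \<delta> \<longrightarrow> \<bar>BC_integral M \<nu> A\<bar> < \<epsilon>" if "0 < \<epsilon>" for \<epsilon>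
  proof -
    have e: "0 < \<epsilon> / 2" using that by simp
    obtain \<delta> where \<delta>: "0 < \<delta>" "\<And>A K. A \<in> sets M \<Longrightarrow> A \<subseteq> space M \<Longrightarrow> has_BC_limit M \<kappa> \<nu> A K \<Longrightarrow>
        \<kappa> A < \<delta> \<Longrightarrow> \<bar>\<nu> A - K\<bar> < \<epsilon> / 2"
      using has_BC_limit_uniform[OF \<kappa>(1) sets.top has_BC_limit_BC_integral[OF \<kappa> sets.top] \<nu>0 e] by metis
    obtain \<delta>' where \<delta>': "0 < \<delta>'" "\<And>A. A \<in> sets M \<Longrightarrow> \<mu> A < \<delta>' \<Longrightarrow> \<bar>\<nu> A\<bar> < \<epsilon> / 2"
      using abs_cont4_small[OF \<mu>(2) \<nu>0 \<mu>(1) e] by metis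
    have "\<bar>BC_integral M \<nu> A\<bar> < \<epsilon>" if A: "A \<in> sets M" "\<kappa> A + \<mu> A < min \<delta> \<delta>'" for A
    proof -
      \<comment> \<open>The bound on \<open>\<kappa>\<close> controls the distance from
        \<open>\<nu> A\<close> to the integral, and the bound on \<open>\<mu>\<close> controls
        \<open>\<nu> A\<close>; each takes half of \<open>\<epsilon>\<close>.\<close>
      have "\<kappa> A < \<delta>" "\<mu> A < \<delta>'"
        using A NA_plusD(5)[OF \<kappa>(1) A(1)] NA_plusD(5)[OF \<mu>(1) A(1)] by auto
      then show ?thesis
        using \<delta>(2)[OF A(1) sets.sets_into_space[OF A(1)] has_BC_limit_BC_integral[OF \<kappa> A(1)]]
          \<delta>'(2)[OF A(1)] by linarith
    qed
    then show ?thesis using \<delta>(1) \<delta>'(1) by (intro exI[of _ "min \<delta> \<delta>'"]) auto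
  qed
  then show ?thesis using that NA_plus_add[OF \<kappa>(1) \<mu>(1)] by blast
qed

text \<open>Cut an atom \<open>A\<close> into blocks so small that
  \<open>\<bar>m I\<bar> < \<bar>m A\<bar>\<close>. No block carries the full value, so each has
  value 0, and summing gives \<open>m A = 0\<close>.\<close>

lemma signed_measure_nonatomic:
  assumes m: "signed_measure M m" and \<sigma>: "\<sigma> \<in> NA_plus M"
    and small: "\<And>\<epsilon>. 0 < \<epsilon> \<Longrightarrow> \<exists>\<delta>>0. \<forall>A\<in>sets M. \<sigma> A < \<delta> \<longrightarrow> \<bar>m A\<bar> < \<epsilon>"
  shows "\<not> atom M m A"
proof
  assume "atom M m A"
  then have A: "A \<in> sets M" "m A \<noteq> 0"
    and at: "\<And>B. B \<in> sets M \<Longrightarrow> B \<subseteq> A \<Longrightarrow> m B = 0 \<or> m (A - B) = 0"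
    by (auto simp: atom_def)
  obtain \<delta> where \<delta>: "\<delta> > 0" "\<forall>B\<in>sets M. \<sigma> B < \<delta> \<longrightarrow> \<bar>m B\<bar> < \<bar>m A\<bar>"
    using small[of "\<bar>m A\<bar>"] A by auto
  obtain D where D: "D \<in> partitions M A" "mesh \<sigma> D < \<delta>"
    using NA_plus_fine_partition[OF \<sigma> A(1) \<delta>(1)] by blast
  note DD = partitionsD[OF D(1)]
  have "m I = 0" if "I \<in> D" for I
  proof -
    have I: "I \<in> sets M" "I \<subseteq> A" using that DD by auto
    have "\<bar>m I\<bar> < \<bar>m A\<bar>" using \<delta>(2) D(2) DD(1) that I by (auto simp: mesh_less_iff)
    then have "m I \<noteq> m A" by auto
    then show ?thesis using at[OF I] signed_measure_Diff[OF m A(1) I] by auto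
  qed
  then have "m A = 0" using signed_measure_Union[OF m DD(1,2,5)] DD(4) by simp
  then show False using A by simp
qed

lemma BC_integral_NA:
  assumes "\<nu> \<in> BC M" "\<nu> \<in> AC4 M"
  shows "BC_integral M \<nu> \<in> NA M"
proof -
  let ?m = "BC_integral M \<nu>"
  obtain \<kappa> where \<kappa>: "\<kappa> \<in> NA_plus M" "BC_integrable M \<kappa> \<nu>" using assms by (auto simp: BC_def)
  obtain \<sigma> where \<sigma>: "\<sigma> \<in> NA_plus M"
    and small: "\<And>\<epsilon>. 0 < \<epsilon> \<Longrightarrow> \<exists>\<delta>>0. \<forall>A\<in>sets M. \<sigma> A < \<delta> \<longrightarrow> \<bar>?m A\<bar> < \<epsilon>"
    using BC_integral_small[OF assms] by metis
  have add: "?m (A \<union> B) = ?m A + ?m B" if AB: "A \<in> sets M" "B \<in> sets M" "A \<inter> B = {}" for A B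
    by (rule has_BC_limit_Un[OF \<kappa>(1) AB, where \<nu> = \<nu>]) (intro has_BC_limit_BC_integral[OF \<kappa>] AB sets.Un)+
  have "signed_measure M ?m"
  proof (rule signed_measureI)
    \<comment> \<open>Additivity for two empty sets gives \<open>?m {} = 2 * ?m {}\<close>.\<close>
    show "game M ?m"
      using add[of "{}" "{}"] by (auto simp: game_def BC_integral_outside)
    show "(\<lambda>n. ?m (A n)) \<longlonglongrightarrow> 0"
      if A: "range A \<subseteq> sets M" "decseq A" "(\<Inter>n. A n) = {}" for A :: "nat \<Rightarrow> 'a set"
    proof (rule LIMSEQ_I)
      fix \<epsilon> :: real assume "0 < \<epsilon>"
      then obtain \<delta> where \<delta>: "\<delta> > 0" "\<forall>A\<in>sets M. \<sigma> A < \<delta> \<longrightarrow> \<bar>?m A\<bar> < \<epsilon>" using small by blast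
      obtain N where N: "\<And>n. n \<ge> N \<Longrightarrow> norm (\<sigma> (A n) - 0) < \<delta>"
        using LIMSEQ_D[OF signed_measure_decseq[OF NA_plusD(1)[OF \<sigma>] A] \<delta>(1)] by blast
      have "norm (?m (A n) - 0) < \<epsilon>" if "n \<ge> N" for n
        using N[OF that] \<delta>(2) A(1) by auto
      then show "\<exists>N. \<forall>n\<ge>N. norm (?m (A n) - 0) < \<epsilon>" by blast
    qed
  qed (rule add)
  then show ?thesis using signed_measure_nonatomic[OF _ \<sigma> small] by (auto simp: NA_def)
qed

section \<open>Automorphisms\<close>

text \<open>\<open>act\<close> uses direct images while measurability concerns preimages; the image
  of a set is its preimage under the inverse map.\<close>

lemma automorphismsD:
  assumes "\<theta> \<in> automorphisms M"
  shows "bij_betw \<theta> (space M) (space M)" "inj_on \<theta> (space M)"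
    "\<And>A. A \<in> sets M \<Longrightarrow> \<theta> ` A \<in> sets M"
    "\<And>A. A \<in> sets M \<Longrightarrow> \<exists>B\<in>sets M. A = \<theta> ` B"
proof -
  have *: "bij_betw \<theta> (space M) (space M)" "\<theta> \<in> measurable M M"
    "inv_into (space M) \<theta> \<in> measurable M M"
    using assms by (auto simp: automorphisms_def)
  then show "bij_betw \<theta> (space M) (space M)" and inj: "inj_on \<theta> (space M)"
    by (auto simp: bij_betw_def)
  show "\<theta> ` A \<in> sets M" if A: "A \<in> sets M" for A
  proof -
    note sub = sets.sets_into_space[OF A]
    have "\<theta> ` A = inv_into (space M) \<theta> -` A \<inter> space M"
    proof (intro equalityI subsetI)
      fix y assume "y \<in> \<theta> ` A"
      then show "y \<in> inv_into (space M) \<theta> -` A \<inter> space M"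
        using sub *(1) inj by (auto simp: bij_betw_def inv_into_f_f subset_iff)
    next
      fix y assume "y \<in> inv_into (space M) \<theta> -` A \<inter> space M"
      then have "y \<in> \<theta> ` space M" "inv_into (space M) \<theta> y \<in> A"
        using *(1) by (auto simp: bij_betw_def)
      then show "y \<in> \<theta> ` A"
        using f_inv_into_f[of y \<theta> "space M"] by (metis imageI)
    qed
    then show ?thesis using measurable_sets[OF *(3) A] by simp
  qed
  show "\<exists>B\<in>sets M. A = \<theta> ` B" if A: "A \<in> sets M" for A
  proof (intro bexI)
    show "\<theta> -` A \<inter> space M \<in> sets M" using measurable_sets[OF *(2) A] .
    show "A = \<theta> ` (\<theta> -` A \<inter> space M)"
    proof (intro equalityI subsetI)
      fix x assume x: "x \<in> A"
      then have "x \<in> \<theta> ` space M"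
        using sets.sets_into_space[OF A] bij_betw_imp_surj_on[OF *(1)] by blast
      then show "x \<in> \<theta> ` (\<theta> -` A \<inter> space M)" using x by blast
    qed blast
  qed
qed

lemma automorphism_image_Diff:
  assumes "\<theta> \<in> automorphisms M" "A \<in> sets M" "B \<in> sets M"
  shows "\<theta> ` (A - B) = \<theta> ` A - \<theta> ` B"
  using inj_on_image_set_diff[OF automorphismsD(2)[OF assms(1)], of A B] sets.sets_into_space assms by blast

lemma automorphism_image_Int:
  assumes "\<theta> \<in> automorphisms M" "A \<in> sets M" "B \<in> sets M"
  shows "\<theta> ` (A \<inter> B) = \<theta> ` A \<inter> \<theta> ` B"
  using inj_on_image_Int[OF automorphismsD(2)[OF assms(1)], of A B] sets.sets_into_space assms by blast

lemma automorphism_image_subset_iff: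
  assumes "\<theta> \<in> automorphisms M" "A \<in> sets M" "B \<in> sets M"
  shows "\<theta> ` A \<subseteq> \<theta> ` B \<longleftrightarrow> A \<subseteq> B"
  by (rule inj_on_image_subset_iff[OF automorphismsD(2)[OF assms(1)]])
    (use assms sets.sets_into_space in auto)

lemma automorphism_image_inj: "\<theta> \<in> automorphisms M \<Longrightarrow> inj_on ((`) \<theta>) (sets M)"
  by (rule inj_onI) (metis automorphism_image_subset_iff order_refl subset_antisym)

lemma game_act: "game M \<nu> \<Longrightarrow> game M (act M \<theta> \<nu>)"
  by (auto simp: game_def act_def)

text \<open>Every measurable subset of \<open>\<theta>\<close>
  A\<open>is the image of a measurable subset of\<close>A\<open>, so an atom\<close>A\<open>of the transported measure would make\<close>\<theta>
  \<open>A\<close> an atom of \<open>\<mu>\<close>.\<close>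

lemma NA_plus_act:
  assumes \<theta>: "\<theta> \<in> automorphisms M" and \<mu>: "\<mu> \<in> NA_plus M"
  shows "act M \<theta> \<mu> \<in> NA_plus M"
proof -
  note \<mu>D = NA_plusD[OF \<mu>] and \<theta>D = automorphismsD[OF \<theta>]
  have "signed_measure M (act M \<theta> \<mu>)"
    unfolding signed_measure_def
  proof (intro conjI allI impI game_act \<mu>D)
    fix A :: "nat \<Rightarrow> 'a set"
    assume A: "range A \<subseteq> sets M" "disjoint_family A"
    have "disjoint_family (\<lambda>i. \<theta> ` A i)"
      unfolding disjoint_family_on_def
    proof (intro ballI impI)
      fix i j :: nat assume "i \<noteq> j"
      then have "A i \<inter> A j = {}" using A(2) by (auto simp: disjoint_family_on_def)
      then show "\<theta> ` A i \<inter> \<theta> ` A j = {}"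
        using automorphism_image_Int[OF \<theta>, of "A i" "A j"] A(1) by auto
    qed
    moreover have "range (\<lambda>i. \<theta> ` A i) \<subseteq> sets M" using A(1) \<theta>D(3) by auto
    ultimately have "(\<lambda>i. \<mu> (\<theta> ` A i)) sums \<mu> (\<Union>i. \<theta> ` A i)"
      using \<mu>D(1) by (auto simp: signed_measure_def)
    moreover have "(\<Union>i. A i) \<in> sets M" using A(1) by auto
    ultimately show "(\<lambda>i. act M \<theta> \<mu> (A i)) sums act M \<theta> \<mu> (\<Union>i. A i)"
      using A(1) by (simp add: act_def image_UN range_subsetD)
  qed
  moreover have "\<not> atom M (act M \<theta> \<mu>) A" for A
  proof
    assume "atom M (act M \<theta> \<mu>) A"
    then have A: "A \<in> sets M" "\<mu> (\<theta> ` A) \<noteq> 0"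
      and at: "\<And>B. B \<in> sets M \<Longrightarrow> B \<subseteq> A \<Longrightarrow> \<mu> (\<theta> ` B) = 0 \<or> \<mu> (\<theta> ` (A - B)) = 0"
      by (auto simp: atom_def act_def)
    have "\<mu> B = 0 \<or> \<mu> (\<theta> ` A - B) = 0" if B: "B \<in> sets M" "B \<subseteq> \<theta> ` A" for B
    proof -
      obtain B' where B': "B' \<in> sets M" "B = \<theta> ` B'" using \<theta>D(4)[OF B(1)] by blast
      then have "B' \<subseteq> A" using B automorphism_image_subset_iff[OF \<theta> B'(1) A(1)] by simp
      then show ?thesis using at[OF B'(1)] B' automorphism_image_Diff[OF \<theta> A(1) B'(1)] by simp
    qed
    then have "atom M \<mu> (\<theta> ` A)" using A \<theta>D(3) by (auto simp: atom_def)
    then show False using \<mu>D(4) by blast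
  qed
  ultimately show ?thesis
    using \<mu>D(5) \<theta>D(3) by (auto simp: NA_plus_def NA_def act_def)
qed

section \<open>Transport of partitions, integrals and chains\<close>

lemma partitions_image:
  assumes \<theta>: "\<theta> \<in> automorphisms M" and D: "D \<in> partitions M E"
  shows "(`) \<theta> ` D \<in> partitions M (\<theta> ` E)"
    and "(\<Sum>I\<in>(`) \<theta> ` D. \<nu> I) = (\<Sum>I\<in>D. act M \<theta> \<nu> I)"
    and "mesh \<kappa> ((`) \<theta> ` D) = mesh (act M \<theta> \<kappa>) D"
proof -
  note DD = partitionsD[OF D] and \<theta>D = automorphismsD[OF \<theta>]
  have "disjoint ((`) \<theta> ` D)"
    unfolding disjoint_def
  proof (intro ballI impI, clarify)
    fix I J assume IJ: "I \<in> D" "J \<in> D" "\<theta> ` I \<noteq> \<theta> ` J"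
    then have "I \<inter> J = {}" using DD(5) by (auto simp: disjoint_def)
    then show "\<theta> ` I \<inter> \<theta> ` J = {}"
      using automorphism_image_Int[OF \<theta>, of I J] DD(2) IJ by auto
  qed
  moreover have "\<Union>((`) \<theta> ` D) = \<theta> ` E" using DD(4) by auto
  ultimately show "(`) \<theta> ` D \<in> partitions M (\<theta> ` E)"
    using DD(1,2,6) \<theta>D(3) by (auto simp: partitions_def partition_on_def)
  have act: "act M \<theta> \<nu> I = \<nu> (\<theta> ` I)" if "I \<in> D" for \<nu> I using that DD(2) by (auto simp: act_def)
  have "inj_on ((`) \<theta>) D" using automorphism_image_inj[OF \<theta>] DD(2) by (rule inj_on_subset)
  then show "(\<Sum>I\<in>(`) \<theta> ` D. \<nu> I) = (\<Sum>I\<in>D. act M \<theta> \<nu> I)"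
    by (simp add: sum.reindex act)
  have "\<kappa> ` (`) \<theta> ` D = act M \<theta> \<kappa> ` D" by (simp add: image_image act cong: image_cong)
  then show "mesh \<kappa> ((`) \<theta> ` D) = mesh (act M \<theta> \<kappa>) D" by (simp add: mesh_def)
qed

text \<open>The control measure is transported together with the game, so a partition of
  \<open>E\<close> and its image have equal meshes and equal sums.\<close>

lemma has_BC_limit_act:
  assumes \<theta>: "\<theta> \<in> automorphisms M" and L: "has_BC_limit M \<kappa> \<nu> (\<theta> ` E) L"
  shows "has_BC_limit M (act M \<theta> \<kappa>) (act M \<theta> \<nu>) E L"
  unfolding has_BC_limit_def
proof (intro allI impI)
  fix \<epsilon> :: real assume "0 < \<epsilon>"
  then obtain \<delta> where \<delta>: "\<delta> > 0" "\<forall>D\<in>partitions M (\<theta> ` E). mesh \<kappa> D < \<delta> \<longrightarrow> \<bar>(\<Sum>I\<in>D. \<nu> I) - L\<bar> < \<epsilon>"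
    using L unfolding has_BC_limit_def by meson
  have "\<bar>(\<Sum>I\<in>D. act M \<theta> \<nu> I) - L\<bar> < \<epsilon>" if D: "D \<in> partitions M E" "mesh (act M \<theta> \<kappa>) D < \<delta>" for D
    using bspec[OF \<delta>(2) partitions_image(1)[OF \<theta> D(1)]] D(2)
    unfolding partitions_image(2,3)[OF \<theta> D(1)] by blast
  then show "\<exists>\<delta>>0. \<forall>D\<in>partitions M E. mesh (act M \<theta> \<kappa>) D < \<delta> \<longrightarrow> \<bar>(\<Sum>I\<in>D. act M \<theta> \<nu> I) - L\<bar> < \<epsilon>"
    using \<delta>(1) by blast
qed

text \<open>The transported game is controlled by \<open>act M \<theta> \<kappa>\<close> instead of
  \<open>\<kappa>\<close>; symmetry follows because the integral may be computed with any admissible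
  control measure.\<close>

lemma BC_act:
  assumes \<theta>: "\<theta> \<in> automorphisms M" and \<nu>: "\<nu> \<in> BC M"
  shows "act M \<theta> \<nu> \<in> BC M"
    and "act M \<theta> (BC_integral M \<nu>) = BC_integral M (act M \<theta> \<nu>)"
proof -
  obtain \<kappa> where \<kappa>: "\<kappa> \<in> NA_plus M" "BC_integrable M \<kappa> \<nu>" using \<nu> by (auto simp: BC_def)
  note \<kappa>' = NA_plus_act[OF \<theta> \<kappa>(1)]
  have lim: "has_BC_limit M (act M \<theta> \<kappa>) (act M \<theta> \<nu>) E (BC_integral M \<nu> (\<theta> ` E))" if "E \<in> sets M" for E
    by (intro has_BC_limit_act[OF \<theta>] has_BC_limit_BC_integral[OF \<kappa>] automorphismsD(3)[OF \<theta>] that)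
  then have int: "BC_integrable M (act M \<theta> \<kappa>) (act M \<theta> \<nu>)" by (auto simp: BC_integrable_def)
  then show "act M \<theta> \<nu> \<in> BC M" using \<nu> \<kappa>' game_act by (auto simp: BC_def)
  show "act M \<theta> (BC_integral M \<nu>) = BC_integral M (act M \<theta> \<nu>)"
  proof
    fix E
    show "act M \<theta> (BC_integral M \<nu>) E = BC_integral M (act M \<theta> \<nu>) E"
      using BC_integral_eq[OF \<kappa>' int _ lim]
      by (cases "E \<in> sets M") (auto simp: BC_integral_outside act_def)
  qed
qed

text \<open>An automorphism maps \<open>{}\<close> and \<open>space M\<close> to themselves and
  preserves inclusions. Its injectivity on measurable sets keeps distinct links distinct, so no term
  of the variation is lost.\<close>

lemma subchain_image:
  assumes \<theta>: "\<theta> \<in> automorphisms M" and \<Lambda>: "subchain M \<Lambda>"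
  shows "subchain M (map_prod ((`) \<theta>) ((`) \<theta>) ` \<Lambda>)"
    and "variation \<nu> (map_prod ((`) \<theta>) ((`) \<theta>) ` \<Lambda>) = variation (act M \<theta> \<nu>) \<Lambda>"
proof -
  note \<theta>D = automorphismsD[OF \<theta>]
  obtain C where C: "chain_of M C" "\<Lambda> \<subseteq> links C" using \<Lambda> by (auto simp: subchain_def)
  have "chain_of M (map ((`) \<theta>) C)"
    using C(1) \<theta>D(1,3) unfolding chain_of_def
    by (auto simp: hd_map last_map bij_betw_def image_mono)
  moreover have "map_prod ((`) \<theta>) ((`) \<theta>) ` \<Lambda> \<subseteq> links (map ((`) \<theta>) C)"
  proof (rule image_subsetI)
    fix l assume "l \<in> \<Lambda>"
    then obtain i where i: "Suc i < length C" "l = (C ! i, C ! Suc i)"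
      using C(2) by (auto simp: links_def)
    then show "map_prod ((`) \<theta>) ((`) \<theta>) l \<in> links (map ((`) \<theta>) C)"
      unfolding links_def by (intro CollectI exI[of _ i]) auto
  qed
  ultimately show "subchain M (map_prod ((`) \<theta>) ((`) \<theta>) ` \<Lambda>)"
    by (auto simp: subchain_def)
  have "\<Lambda> \<subseteq> sets M \<times> sets M" using subchainD[OF \<Lambda>] by auto
  then have "inj_on (map_prod ((`) \<theta>) ((`) \<theta>)) \<Lambda>"
    using map_prod_inj_on[OF automorphism_image_inj[OF \<theta>] automorphism_image_inj[OF \<theta>]]
    by (rule inj_on_subset[rotated])
  then show "variation \<nu> (map_prod ((`) \<theta>) ((`) \<theta>) ` \<Lambda>) = variation (act M \<theta> \<nu>) \<Lambda>"
    using subchainD[OF \<Lambda>] unfolding variation_def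
    by (auto simp: sum.reindex act_def intro!: sum.cong)
qed

lemma AC4_act:
  assumes \<theta>: "\<theta> \<in> automorphisms M" and \<nu>: "\<nu> \<in> AC4 M"
  shows "act M \<theta> \<nu> \<in> AC4 M"
proof -
  obtain \<mu> where \<mu>: "\<mu> \<in> NA_plus M" "abs_cont4 M \<nu> \<mu>" using \<nu> by (auto simp: AC4_def)
  have "abs_cont4 M (act M \<theta> \<nu>) (act M \<theta> \<mu>)"
    unfolding abs_cont4_def
  proof (intro allI impI)
    fix \<epsilon> :: real assume "0 < \<epsilon>"
    then obtain \<delta> where \<delta>: "\<delta> > 0" "\<forall>\<Lambda>. subchain M \<Lambda> \<longrightarrow> variation \<mu> \<Lambda> < \<delta> \<longrightarrow> variation \<nu> \<Lambda> < \<epsilon>"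
      using \<mu>(2) unfolding abs_cont4_def by meson
    have "variation (act M \<theta> \<nu>) \<Lambda> < \<epsilon>"
      if "subchain M \<Lambda>" "variation (act M \<theta> \<mu>) \<Lambda> < \<delta>" for \<Lambda>
      using \<delta>(2)[rule_format, OF subchain_image(1)[OF \<theta> that(1)]] that(2)
      by (simp add: subchain_image(2)[OF \<theta> that(1)])
    then show "\<exists>\<delta>>0. \<forall>\<Lambda>. subchain M \<Lambda> \<longrightarrow> variation (act M \<theta> \<mu>) \<Lambda> < \<delta> \<longrightarrow> variation (act M \<theta> \<nu>) \<Lambda> < \<epsilon>"
      using \<delta>(1) by blast
  qed
  then show ?thesis using \<nu> NA_plus_act[OF \<theta> \<mu>(1)] game_act by (auto simp: AC4_def)
qed

section \<open>Assembling the semivalue\<close>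

lemma zero_BC_AC4: "(\<lambda>A. 0) \<in> BC M \<inter> AC4 M"
proof -
  have "signed_measure M (\<lambda>A. 0)" using NA_plusD(1)[OF zero_NA_plus] .
  then have "BC_integrable M (\<lambda>A. 0) (\<lambda>A. 0)"
    unfolding BC_integrable_def by (blast dest: has_BC_limit_signed_measure)
  moreover have "abs_cont4 M (\<lambda>A. 0) (\<lambda>A. 0)"
    by (auto simp: abs_cont4_def variation_def)
  ultimately show ?thesis
    using zero_NA_plus by (auto simp: BC_def AC4_def game_def)
qed

theorem corollary3p1:
  fixes M :: "'a measure"
  assumes "standard_borel M"
  shows "semivalue M (BC M \<inter> AC4 M) (BC_integral M)"
proof -
  have "symmetric_subspace M (BC M \<inter> AC4 M)"
    unfolding symmetric_subspace_def
  proof (intro conjI ballI allI)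
    show "BC M \<inter> AC4 M \<subseteq> BV M" using AC4_subset_BV by blast
  qed (use zero_BC_AC4 BC_add(1) AC4_add BC_cmult(1) AC4_cmult BC_act(1) AC4_act in auto)
  then show ?thesis
    unfolding semivalue_def
  proof (intro conjI ballI allI impI)
    fix \<nu> assume "\<nu> \<in> NA M \<inter> (BC M \<inter> AC4 M)"
    then show "BC_integral M \<nu> = \<nu>" by (intro BC_integral_signed_measure) (auto simp: NA_def)
  qed (use BC_integral_NA BC_add(2) BC_cmult(2) BC_act(2) BC_integral_nonneg in auto)
qed

end
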